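(* For $|q|<1$, $$\mathrm{C}\Phi_6(q)=\frac49\frac{(q;q)_\infty^5(q^4;q^4)_\infty^2}{(q^2;q^2)_\infty^5(q^3;q^3)_\infty^3}-\frac13\frac{(q^2;q^2)_\infty^4(q^4;q^4)_\infty^2}{(q;q)_\infty^4(q^6;q^6)_\infty^3}+\frac89\frac{(q^4;q^4)_\infty^{11}}{(q;q)_\infty^4(q^2;q^2)_\infty^5(q^{12};q^{12})_\infty^3}$$ $$+36q\frac{(q^4;q^4)_\infty^2(q^3;q^3)_\infty^9}{(q;q)_\infty^7(q^2;q^2)_\infty^5}+27q^2\frac{(q^4;q^4)_\infty^2(q^6;q^6)_\infty^9}{(q;q)_\infty^4(q^2;q^2)_\infty^8}+72q^4\frac{(q^{12};q^{12})_\infty^9}{(q;q)_\infty^4(q^2;q^2)_\infty^5(q^4;q^4)_\infty}.$$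
   Context: A $k$-colored generalized Frobenius symbol is a two-row array with $d\ge 0$ columns whose entries are colored nonnegative integers $\ell_c$ ($\ell\ge 0$, color $c\in\{1,\dots,k\}$), each row strictly decreasing with respect to the total order $0_1\prec 0_2\prec\cdots\prec 0_k\prec 1_1\prec\cdots\prec 1_k\prec 2_1\prec\cdots$. It is a $k$-colored generalized Frobenius partition of $n=d+\sum(\text{integer values of all entries})$. $c\phi_k(n)$ is the number of such partitions of $n$ (with $c\phi_k(0)=1$), and $\mathrm{C}\Phi_k(q)=\sum_{n\ge0}c\phi_k(n)q^n$. $(a;q)_\infty=\prod_{j\ge1}(1-aq^{j-1})$. *)

theory Defs
  imports "HOL-Analysis.Analysis"
begin

text \<open>The pair \<open>(l, c)\<close> encodes the integer \<open>l\<close> in color \<open>c\<close>.\<close>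

definition colored_less :: "nat \<times> nat \<Rightarrow> nat \<times> nat \<Rightarrow> bool" where
  "colored_less x y \<longleftrightarrow> fst x < fst y \<or> (fst x = fst y \<and> snd x < snd y)"

definition frobenius_row :: "nat \<Rightarrow> (nat \<times> nat) list \<Rightarrow> bool" where
  "frobenius_row k r \<longleftrightarrow>
     (\<forall>x \<in> set r. snd x \<in> {1..k}) \<and> sorted_wrt (\<lambda>x y. colored_less y x) r"

text \<open>A symbol is the pair of its rows, each read from left to right.\<close>

definition frobenius_symbol :: "nat \<Rightarrow> (nat \<times> nat) list \<times> (nat \<times> nat) list \<Rightarrow> bool" where
  "frobenius_symbol k s \<longleftrightarrow>
     length (fst s) = length (snd s) \<and> frobenius_row k (fst s) \<and> frobenius_row k (snd s)"

definition frobenius_weight :: "(nat \<times> nat) list \<times> (nat \<times> nat) list \<Rightarrow> nat" where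
  "frobenius_weight s =
     length (fst s) + sum_list (map fst (fst s)) + sum_list (map fst (snd s))"

definition frobenius_partitions :: "nat \<Rightarrow> nat \<Rightarrow> ((nat \<times> nat) list \<times> (nat \<times> nat) list) set" where
  "frobenius_partitions k n = {s. frobenius_symbol k s \<and> frobenius_weight s = n}"

definition cphi :: "nat \<Rightarrow> nat \<Rightarrow> nat" where
  "cphi k n = card (frobenius_partitions k n)"

definition CPhi :: "nat \<Rightarrow> complex \<Rightarrow> complex" where
  "CPhi k q = (\<Sum>n. of_nat (cphi k n) * q ^ n)"

definition qpochhammer_inf :: "complex \<Rightarrow> complex \<Rightarrow> complex" where
  "qpochhammer_inf a q = (\<Prod>j. 1 - a * q ^ j)"

abbreviation euler_prod :: "complex \<Rightarrow> complex" where
  "euler_prod q \<equiv> qpochhammer_inf q q"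

text \<open>Finiteness ensures that the cardinality defining \<open>cphi\<close> is a genuine count.\<close>

lemma finite_frobenius_partitions: "finite (frobenius_partitions k n)"
proof (rule finite_subset)
  let ?L = "{r. set r \<subseteq> {0..n} \<times> {1..k} \<and> length r \<le> n}"
  show "finite (?L \<times> ?L)"
    by (intro finite_cartesian_product finite_lists_length_le) auto
  have mem: "fst x \<le> sum_list (map fst r)" if "x \<in> set r" for x and r :: "(nat \<times> nat) list"
    using that by (intro member_le_sum_list) auto
  show "frobenius_partitions k n \<subseteq> ?L \<times> ?L"
    unfolding frobenius_partitions_def frobenius_symbol_def frobenius_row_def
      frobenius_weight_def
    by (fastforce dest: mem)
qed

lemma cphi_0: "cphi k 0 = 1"
proof -
  have "frobenius_partitions k 0 = {([], [])}"
    by (auto simp: frobenius_partitions_def frobenius_symbol_def frobenius_row_def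
        frobenius_weight_def)
  then show ?thesis by (simp add: cphi_def)
qed

end

theory Submission
  imports Defs
begin

text \<open>
  Write \<open>E\<^sub>n = (q\<^sup>n; q\<^sup>n)\<^sub>\<infinity>\<close>. The two rows of a symbol are finite sets of coloured integers, so by the
  Jacobi triple product \<open>E\<^sub>1\<^sup>6 C\<Phi>\<^sub>6\<close> is the constant term in \<open>z\<close> of the sixth power of
  \<open>\<theta>(z) = \<Sum> q\<^bsup>m(m+1)/2\<^esup> z\<^sup>m\<close>. The coefficients of \<open>\<theta>(z)\<^sup>3\<close> are theta series of the hexagonal lattice and
  of one of its cosets, \<open>a(q)\<close> and \<open>L(q)\<close>, and squaring gives
  \<open>E\<^sub>1\<^sup>6 C\<Phi>\<^sub>6 = \<phi>(q\<^sup>3) a(q)\<^sup>2 + 2 q L(q)\<^sup>2 \<Sum> q\<^bsup>s(3s+2)\<^esup>\<close>.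

  The products \<open>\<theta>(z) \<theta>(\<omega>z) \<theta>(\<omega>\<^sup>2z)\<close> with \<open>\<omega>\<^sup>3 = 1\<close> and, with \<open>q\<^sup>3\<close> in place of \<open>q\<close>, \<open>\<theta>(z) \<theta>(z/q) \<theta>(z/q\<^sup>2)\<close>
  are again theta series; comparing constant terms evaluates the lattice sums \<open>b(q) = E\<^sub>1\<^sup>3 / E\<^sub>3\<close> and
  \<open>c(q) = E\<^sub>3\<^sup>3 / E\<^sub>1 = L(q) / 3\<close>. The summands of \<open>b\<close> and \<open>L\<close> are invariant under a rotation of order three,
  which permutes three of the four parity classes. With \<open>D = q E\<^sub>2\<^sup>2 E\<^sub>1\<^sub>2\<^sup>3 / (E\<^sub>4 E\<^sub>6\<^sup>2)\<close> this gives
  \<open>b(q) = b(q\<^sup>4) - 3 D\<close> and \<open>c(q) = (E\<^sub>6 / E\<^sub>2)\<^sup>2 (b(q\<^sup>4) + D)\<close>. After multiplication by \<open>\<phi>(q)\<close> both sides of the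
  theorem become rational functions of \<open>b(q\<^sup>4)\<close> and \<open>D\<close>, and they agree.
\<close>

section \<open>Unordered infinite sums\<close>

lemma has_sum_times:
  fixes f :: "'a \<Rightarrow> complex" and g :: "'b \<Rightarrow> complex"
  assumes f: "(f has_sum a) A" and g: "(g has_sum b) B"
  shows "((\<lambda>(x, y). f x * g y) has_sum a * b) (A \<times> B)"
proof (rule has_sum_SigmaI)
  show "((\<lambda>y. case (x, y) of (x, y) \<Rightarrow> f x * g y) has_sum f x * b) B" for x
    using has_sum_cmult_right[OF g, of "f x"] by simp
  show "((\<lambda>x. f x * b) has_sum a * b) A"
    using has_sum_cmult_left[OF f, of b] by simp
  have "(\<lambda>x. norm (f x)) summable_on A" "(\<lambda>x. norm (g x)) summable_on B"
    using f g by (auto dest: has_sum_imp_summable simp: summable_on_iff_abs_summable_on_complex)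
  then have "(\<lambda>p. norm ((\<lambda>(x, y). f x * g y) p)) summable_on A \<times> B"
    by (intro Infinite_Sum.abs_summable_on_Sigma_iff[THEN iffD2])
       (auto simp: norm_mult abs_mult infsum_cmult_right' infsum_nonneg
         intro: summable_on_cmult_right summable_on_cmult_left)
  then show "(\<lambda>(x, y). f x * g y) summable_on A \<times> B"
    by (rule abs_summable_summable)
qed

lemma has_sum_powi_times:
  fixes q :: complex
  assumes "q \<noteq> 0" "((\<lambda>m. q powi d m) has_sum a) A" "((\<lambda>n. q powi e n) has_sum b) B"
  shows "((\<lambda>(m, n). q powi (d m + e n)) has_sum a * b) (A \<times> B)"
  using has_sum_times[OF assms(2,3)] by (simp add: power_int_add assms(1))

lemma has_sum_sum:
  fixes f :: "'i \<Rightarrow> 'a \<Rightarrow> 'b :: topological_comm_monoid_add"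
  assumes "\<And>i. i \<in> I \<Longrightarrow> (f i has_sum a i) A"
  shows "((\<lambda>x. \<Sum>i\<in>I. f i x) has_sum (\<Sum>i\<in>I. a i)) A"
  using assms by (induction I rule: infinite_finite_induct) (auto intro!: has_sum_add)

lemma infsum_split:
  fixes f :: "'a \<Rightarrow> 'b :: banach"
  assumes "f summable_on S"
  shows "infsum f S = infsum f {x \<in> S. p x} + infsum f {x \<in> S. \<not> p x}"
proof -
  have "infsum f ({x \<in> S. p x} \<union> {x \<in> S. \<not> p x}) = infsum f {x \<in> S. p x} + infsum f {x \<in> S. \<not> p x}"
    by (rule infsum_Un_disjoint) (auto intro: summable_on_subset_banach[OF assms])
  moreover have "{x \<in> S. p x} \<union> {x \<in> S. \<not> p x} = S" by auto
  ultimately show ?thesis by simp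
qed

lemma infsum_split_involution:
  fixes f :: "'a \<Rightarrow> 'b :: {banach, real_normed_field}"
  assumes summable: "f summable_on UNIV" and invariant: "\<And>x. f (\<sigma> x) = f x"
    and involution: "\<And>x. \<sigma> (\<sigma> x) = x" and flips: "\<And>x. p (\<sigma> x) \<longleftrightarrow> \<not> p x"
  shows "infsum f UNIV = 2 * infsum f {x. p x}"
proof -
  have "infsum f {x. \<not> p x} = infsum f {x. p x}"
    by (rule infsum_reindex_bij_witness[of _ \<sigma> \<sigma>]) (auto simp: invariant involution flips)
  then show ?thesis
    using infsum_split[OF summable, of p] by simp
qed

lemma infsum_split_rotation:
  fixes f :: "'a \<Rightarrow> 'b :: {banach, real_normed_field}"
  assumes "f summable_on UNIV" and invariant: "\<And>x. f (\<rho> x) = f x"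
    and order_three: "\<And>x. \<rho> (\<rho> (\<rho> x)) = x" and moves: "\<And>x. p x \<Longrightarrow> \<not> p (\<rho> x)"
  shows "infsum f UNIV = 3 * infsum f {x. p x} + infsum f {x. \<not> p x \<and> \<not> p (\<rho> x) \<and> \<not> p (\<rho> (\<rho> x))}"
proof -
  have summable: "f summable_on S" for S
    using assms(1) by (rule summable_on_subset_banach) simp
  have once: "infsum f {x. p (\<rho> x)} = infsum f {x. p x}"
    by (rule infsum_reindex_bij_witness[of _ "\<lambda>x. \<rho> (\<rho> x)" \<rho>]) (auto simp: invariant order_three)
  have twice: "infsum f {x. p (\<rho> (\<rho> x))} = infsum f {x. p x}"
    by (rule infsum_reindex_bij_witness[of _ \<rho> "\<lambda>x. \<rho> (\<rho> x)"]) (auto simp: invariant order_three)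
  have "\<not> p (\<rho> (\<rho> x))" if "p x" for x
    using moves[of "\<rho> (\<rho> x)"] that by (auto simp: order_three)
  then have classes: "{x. \<not> p x \<and> p (\<rho> x)} = {x. p (\<rho> x)}"
    "{x. \<not> p x \<and> \<not> p (\<rho> x) \<and> p (\<rho> (\<rho> x))} = {x. p (\<rho> (\<rho> x))}"
    using moves by blast+
  show ?thesis
    using infsum_split[OF summable, of UNIV p] infsum_split[OF summable, of "{x. \<not> p x}" "\<lambda>x. p (\<rho> x)"]
      infsum_split[OF summable, of "{x. \<not> p x \<and> \<not> p (\<rho> x)}" "\<lambda>x. p (\<rho> (\<rho> x))"]
    by (simp add: classes once twice)
qed

lemma infsum_dominated_convergence:
  fixes f :: "nat \<Rightarrow> 'a \<Rightarrow> 'b :: {banach, second_countable_topology}"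
  assumes lim: "\<And>x. x \<in> A \<Longrightarrow> (\<lambda>n. f n x) \<longlonglongrightarrow> g x"
    and bound: "\<And>n x. x \<in> A \<Longrightarrow> norm (f n x) \<le> h x"
    and h: "h summable_on A"
  shows "(\<lambda>n. infsum (f n) A) \<longlonglongrightarrow> infsum g A"
proof -
  have summable_bound: "Infinite_Set_Sum.abs_summable_on h A"
    using summable_on_iff_abs_summable_on_real[THEN iffD1, OF h] by (simp flip: abs_summable_equivalent)
  have "norm (g x) \<le> h x" if "x \<in> A" for x
    using lim[OF that] bound[OF that] by (intro Lim_norm_ubound[of sequentially "\<lambda>n. f n x"]) auto
  then have summable_limit: "Infinite_Set_Sum.abs_summable_on g A"
    by (intro abs_summable_on_comparison_test[OF summable_bound]) fastforce
  have summable_terms: "Infinite_Set_Sum.abs_summable_on (f n) A" for n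
    using order_trans[OF bound abs_ge_self] by (intro abs_summable_on_comparison_test[OF summable_bound]) simp
  have "(\<lambda>n. infsetsum (f n) A) \<longlonglongrightarrow> infsetsum g A"
    unfolding infsetsum_def
    using summable_bound lim bound
    by (intro integral_dominated_convergence[where w = h])
       (auto simp: AE_count_space Infinite_Set_Sum.abs_summable_on_def)
  then show ?thesis
    by (simp add: infsetsum_infsum summable_terms summable_limit)
qed

lemma has_sum_int_mod_3:
  fixes f :: "int \<Rightarrow> 'a :: topological_comm_monoid_add"
  assumes "((\<lambda>s. f (3 * s)) has_sum a) UNIV" "((\<lambda>s. f (3 * s + 1)) has_sum b) UNIV"
    "((\<lambda>s. f (3 * s - 1)) has_sum c) UNIV"
  shows "(f has_sum a + b + c) UNIV"
proof -
  have residue_class: "(f has_sum d) (range (\<lambda>s. 3 * s + r))"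
    if "((\<lambda>s. f (3 * s + r)) has_sum d) UNIV" for d r
    using that by (subst has_sum_reindex) (auto simp: inj_def o_def)
  have "(f has_sum a + b + c) (range (\<lambda>s. 3 * s + 0) \<union> range (\<lambda>s. 3 * s + 1) \<union> range (\<lambda>s. 3 * s + (- 1)))"
    using assms by (intro has_sum_Un_disjoint residue_class; auto; presburger)
  also have "range (\<lambda>s. 3 * s + 0) \<union> range (\<lambda>s. 3 * s + 1) \<union> range (\<lambda>s. 3 * s + (- 1)) = (UNIV :: int set)"
    unfolding set_eq_iff image_iff Un_iff by auto presburger
  finally show ?thesis .
qed

lemma filterlim_finite_subsets_at_top_incseq:
  assumes "incseq A" "\<And>n. finite (A n)" "(\<Union>n. A n) = S"
  shows "filterlim A (finite_subsets_at_top S) sequentially"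
  unfolding filterlim_finite_subsets_at_top
proof (intro allI impI)
  fix X assume "finite X \<and> X \<subseteq> S"
  then have X: "finite X" "X \<subseteq> \<Union>(range A)" using assms(3) by auto
  have "A i \<subseteq> A j \<or> A j \<subseteq> A i" for i j
    using incseqD[OF assms(1)] by (cases i j rule: le_cases) auto
  then have chain: "subset.chain UNIV (range A)"
    by (auto simp: subset_chain_def)
  obtain B where "B \<in> range A" "X \<subseteq> B"
    using X by (rule finite_subset_Union_chain[OF _ _ _ chain]) auto
  then obtain n0 where "X \<subseteq> A n0" by blast
  then show "\<forall>\<^sub>F n in sequentially. finite (A n) \<and> X \<subseteq> A n \<and> A n \<subseteq> S"
    using assms incseqD[OF assms(1)] by (intro eventually_sequentiallyI[of n0]) blast
qed

section \<open>Expanding infinite products over finite subsets\<close>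

lemma prod_one_plus_eq_sum_Pow:
  fixes x :: "'a \<Rightarrow> 'b :: comm_ring_1"
  assumes "finite A"
  shows "(\<Prod>i\<in>A. 1 + x i) = (\<Sum>X\<in>Pow A. \<Prod>i\<in>X. x i)"
  using prod_add[OF assms, of x "\<lambda>_. 1"] by (simp add: add.commute)

lemma abs_summable_on_Fpow_prod:
  fixes x :: "'a \<Rightarrow> 'b :: real_normed_field"
  assumes "(\<lambda>i. norm (x i)) summable_on I"
  shows "(\<lambda>X. norm (\<Prod>i\<in>X. x i)) summable_on Fpow I"
proof (rule nonneg_bdd_above_summable_on)
  show "bdd_above (sum (\<lambda>X. norm (\<Prod>i\<in>X. x i)) ` {F. F \<subseteq> Fpow I \<and> finite F})"
  proof (rule bdd_aboveI2)
    fix F assume "F \<in> {F. F \<subseteq> Fpow I \<and> finite F}"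
    then have covers: "finite (\<Union>F)" "\<Union>F \<subseteq> I" "F \<subseteq> Pow (\<Union>F)" by (auto simp: Fpow_def)
    have "(\<Sum>X\<in>F. norm (\<Prod>i\<in>X. x i)) = (\<Sum>X\<in>F. \<Prod>i\<in>X. norm (x i))"
      by (simp add: prod_norm)
    also have "\<dots> \<le> (\<Sum>X\<in>Pow (\<Union>F). \<Prod>i\<in>X. norm (x i))"
      using covers by (intro sum_mono2) (auto intro: prod_nonneg)
    also have "\<dots> = (\<Prod>i\<in>\<Union>F. 1 + norm (x i))"
      using covers by (simp add: prod_one_plus_eq_sum_Pow)
    also have "\<dots> \<le> exp (\<Sum>i\<in>\<Union>F. norm (x i))"
      using prod_le_exp_sum[of "\<Union>F" "\<lambda>i. norm (x i)"] by simp
    also have "\<dots> \<le> exp (infsum (\<lambda>i. norm (x i)) I)"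
      using finite_sum_le_infsum[OF assms covers(1,2)] by simp
    finally show "(\<Sum>X\<in>F. norm (\<Prod>i\<in>X. x i)) \<le> exp (infsum (\<lambda>i. norm (x i)) I)" .
  qed
qed auto

lemma has_sum_Fpow_prod:
  fixes x :: "'a \<Rightarrow> 'b :: {real_normed_field, banach}"
  assumes x: "(\<lambda>i. norm (x i)) summable_on I"
    and A: "incseq A" "\<And>n. finite (A n)" "(\<Union>n. A n) = I"
    and lim: "(\<lambda>n. \<Prod>i\<in>A n. 1 + x i) \<longlonglongrightarrow> P"
  shows "((\<lambda>X. \<Prod>i\<in>X. x i) has_sum P) (Fpow I)"
proof -
  obtain S where S: "((\<lambda>X. \<Prod>i\<in>X. x i) has_sum S) (Fpow I)"
    using abs_summable_summable[OF abs_summable_on_Fpow_prod[OF x]] by (auto simp: summable_on_def)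
  have "filterlim (\<lambda>n. Pow (A n)) (finite_subsets_at_top (Fpow I)) sequentially"
  proof (rule filterlim_finite_subsets_at_top_incseq)
    show "(\<Union>n. Pow (A n)) = Fpow I"
    proof (intro equalityI subsetI)
      fix X assume "X \<in> Fpow I"
      then have "\<forall>\<^sub>F n in sequentially. X \<subseteq> A n"
        using filterlim_finite_subsets_at_top_incseq[OF A]
        unfolding filterlim_finite_subsets_at_top Fpow_def by (fast elim: eventually_mono)
      then show "X \<in> (\<Union>n. Pow (A n))" by (auto simp: eventually_at_top_linorder)
    qed (use A in \<open>auto simp: Fpow_def intro: finite_subset\<close>)
  qed (use A in \<open>simp_all add: incseq_def Pow_mono\<close>)
  from filterlim_compose[OF S[unfolded has_sum_def] this]
  have "(\<lambda>n. \<Prod>i\<in>A n. 1 + x i) \<longlonglongrightarrow> S"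
    using A(2) by (simp add: prod_one_plus_eq_sum_Pow)
  then show ?thesis using S LIMSEQ_unique[OF lim] by metis
qed

section \<open>Constant terms\<close>

lemma sum_roots_unity_powi_eq_0:
  assumes "d \<noteq> 0" "nat \<bar>d\<bar> < N"
  shows "(\<Sum>z | z ^ N = 1. z powi d) = (0 :: complex)"
proof -
  have "card {z :: complex. z ^ nat \<bar>d\<bar> = 1} < card {z :: complex. z ^ N = 1}"
    using assms by (simp add: card_roots_unity_eq)
  moreover have "finite {z :: complex. z ^ nat \<bar>d\<bar> = 1}"
    using assms(1) by (intro finite_nth_roots) simp
  ultimately have "\<not> {z :: complex. z ^ N = 1} \<subseteq> {z. z ^ nat \<bar>d\<bar> = 1}"
    by (meson card_mono leD)
  then obtain \<zeta> :: complex where \<zeta>: "\<zeta> ^ N = 1" "\<zeta> ^ nat \<bar>d\<bar> \<noteq> 1" by auto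
  then have "\<zeta> \<noteq> 0" "\<zeta> powi d \<noteq> 1"
    using assms by (auto simp: power_0_left power_int_def power_inverse abs_if split: if_splits)
  have "bij_betw (\<lambda>z. \<zeta> * z) {z. z ^ N = 1} {z. z ^ N = 1}"
    using \<zeta> \<open>\<zeta> \<noteq> 0\<close>
    by (intro bij_betwI[where g = "\<lambda>z. z / \<zeta>"]) (auto simp: power_mult_distrib power_divide)
  then have "(\<Sum>z | z ^ N = 1. z powi d) = (\<Sum>z | z ^ N = 1. (\<zeta> * z) powi d)"
    by (rule sum.reindex_bij_betw[symmetric])
  also have "\<dots> = \<zeta> powi d * (\<Sum>z | z ^ N = 1. z powi d)"
    by (simp add: power_int_mult_distrib sum_distrib_left)
  finally show ?thesis using \<open>\<zeta> powi d \<noteq> 1\<close> by simp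
qed

text \<open>Averaging over the roots of unity of order \<open>N\<close> keeps only the terms whose degree is divisible by \<open>N\<close>;
  as \<open>N\<close> grows, only degree \<open>0\<close> survives.\<close>

lemma root_unity_average_tendsto_constant_term:
  fixes w :: "'a \<Rightarrow> complex" and d :: "'a \<Rightarrow> int" and f :: "complex \<Rightarrow> complex"
  assumes expansion: "\<And>z. norm z = 1 \<Longrightarrow> ((\<lambda>s. w s * z powi d s) has_sum f z) S"
  shows "(\<lambda>n. (\<Sum>z | z ^ Suc n = 1. f z) / of_nat (Suc n)) \<longlonglongrightarrow> infsum w {s \<in> S. d s = 0}"
proof -
  define average where "average n s = (\<Sum>z | z ^ Suc n = (1 :: complex). z powi d s) / of_nat (Suc n)" for n s
  have norm_root: "norm z = 1" if "z ^ Suc n = 1" for z :: complex and n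
    using power_eq_1_iff[OF that] by simp
  have norm_average: "norm (average n s) \<le> 1" for n s
  proof -
    have "norm (\<Sum>z | z ^ Suc n = (1 :: complex). z powi d s) \<le> (\<Sum>z | z ^ Suc n = (1 :: complex). 1)"
      by (intro sum_norm_le) (auto simp: norm_power_int norm_root simp del: power_Suc)
    then show ?thesis
      by (simp add: average_def norm_divide card_roots_unity_eq del: power_Suc of_nat_Suc)
  qed
  have lim_average: "(\<lambda>n. average n s) \<longlonglongrightarrow> of_bool (d s = 0)" for s
  proof (rule tendsto_eventually, rule eventually_sequentiallyI[of "nat \<bar>d s\<bar>"])
    show "average n s = of_bool (d s = 0)" if "n \<ge> nat \<bar>d s\<bar>" for n
      using that
      by (auto simp: average_def sum_roots_unity_powi_eq_0 card_roots_unity_eq simp del: power_Suc of_nat_Suc)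
  qed
  have "(\<lambda>s. norm (w s)) summable_on S"
    using expansion[of 1] by (auto dest: has_sum_imp_summable simp: summable_on_iff_abs_summable_on_complex)
  then have "(\<lambda>n. infsum (\<lambda>s. average n s * w s) S) \<longlonglongrightarrow> infsum (\<lambda>s. of_bool (d s = 0) * w s) S"
    using norm_average by (intro infsum_dominated_convergence tendsto_mult lim_average tendsto_const)
      (auto simp: norm_mult mult_left_le_one_le)
  moreover have "infsum (\<lambda>s. of_bool (d s = 0) * w s) S = infsum w {s \<in> S. d s = 0}"
    by (rule infsum_cong_neutral) auto
  moreover have "infsum (\<lambda>s. average n s * w s) S = (\<Sum>z | z ^ Suc n = 1. f z) / of_nat (Suc n)" for n
  proof (rule infsumI)
    have "((\<lambda>s. \<Sum>z | z ^ Suc n = 1. w s * z powi d s) has_sum (\<Sum>z | z ^ Suc n = 1. f z)) S"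
      by (intro has_sum_sum expansion) (auto simp: norm_root simp del: power_Suc)
    from has_sum_cmult_left[OF this, of "1 / of_nat (Suc n)"]
    show "((\<lambda>s. average n s * w s) has_sum (\<Sum>z | z ^ Suc n = 1. f z) / of_nat (Suc n)) S"
      by (simp add: average_def mult.commute flip: sum_distrib_left del: power_Suc of_nat_Suc)
  qed
  ultimately show ?thesis by simp
qed

lemma constant_term_unique:
  fixes w :: "'a \<Rightarrow> complex" and w' :: "'b \<Rightarrow> complex"
  assumes "\<And>z. norm z = 1 \<Longrightarrow> ((\<lambda>s. w s * z powi d s) has_sum f z) S"
    and "\<And>z. norm z = 1 \<Longrightarrow> ((\<lambda>s. w' s * z powi d' s) has_sum f z) S'"
  shows "infsum w {s \<in> S. d s = 0} = infsum w' {s \<in> S'. d' s = 0}"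
  using root_unity_average_tendsto_constant_term[OF assms(1)]
    root_unity_average_tendsto_constant_term[OF assms(2)]
  by (rule LIMSEQ_unique)

section \<open>q-Pochhammer symbols\<close>

lemma convergent_prod_qpochhammer:
  assumes "norm q < 1"
  shows "convergent_prod (\<lambda>j. 1 - a * q ^ j :: complex)"
proof -
  have "summable (\<lambda>j. norm a * norm q ^ j)"
    using assms by (intro summable_mult summable_geometric) auto
  then have "abs_convergent_prod (\<lambda>j. 1 - a * q ^ j)"
    by (simp add: abs_convergent_prod_conv_summable norm_mult norm_power)
  then show ?thesis by (rule abs_convergent_prod_imp_convergent_prod)
qed

lemma LIMSEQ_qpochhammer_inf:
  assumes "norm q < 1"
  shows "(\<lambda>n. \<Prod>j<n. 1 - a * q ^ j) \<longlonglongrightarrow> qpochhammer_inf a q"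
  using convergent_prod_LIMSEQ[OF convergent_prod_qpochhammer[OF assms, of a]]
  unfolding qpochhammer_inf_def LIMSEQ_lessThan_iff_atMost .

lemma qpochhammer_inf_unfold:
  assumes "norm q < 1"
  shows "qpochhammer_inf a q = (1 - a) * qpochhammer_inf (a * q) q"
proof -
  have "(\<lambda>n. \<Prod>j<Suc n. 1 - a * q ^ j) \<longlonglongrightarrow> qpochhammer_inf a q"
    using LIMSEQ_qpochhammer_inf[OF assms] by (rule LIMSEQ_Suc)
  moreover have "(\<lambda>n. (1 - a) * (\<Prod>j<n. 1 - a * q * q ^ j)) \<longlonglongrightarrow> (1 - a) * qpochhammer_inf (a * q) q"
    by (intro tendsto_intros LIMSEQ_qpochhammer_inf assms)
  ultimately show ?thesis
    by (simp add: prod.lessThan_Suc_shift mult.assoc LIMSEQ_unique del: prod.lessThan_Suc)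
qed

lemma qpochhammer_inf_dissect:
  assumes "norm q < 1" "k > 0"
  shows "qpochhammer_inf a q = (\<Prod>i<k. qpochhammer_inf (a * q ^ i) (q ^ k))"
proof -
  have "(\<Prod>j<n * k. 1 - a * q ^ j) = (\<Prod>i<k. \<Prod>j<n. 1 - a * q ^ i * (q ^ k) ^ j)" for n
  proof -
    have "(\<Prod>j<n * k. 1 - a * q ^ j) = (\<Prod>j<n. \<Prod>i\<in>{j * k..<j * k + k}. 1 - a * q ^ i)"
      by (simp add: prod.nat_group)
    also have "\<dots> = (\<Prod>j<n. \<Prod>i<k. 1 - a * q ^ (i + j * k))"
      using prod.shift_bounds_nat_ivl[of "\<lambda>i. 1 - a * q ^ i" 0 "_ * k" k]
      by (simp add: add.commute lessThan_atLeast0)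
    also have "\<dots> = (\<Prod>i<k. \<Prod>j<n. 1 - a * q ^ (i + j * k))"
      by (rule prod.swap)
    also have "\<dots> = (\<Prod>i<k. \<Prod>j<n. 1 - a * q ^ i * (q ^ k) ^ j)"
      by (simp add: power_add mult.commute[of _ k] power_mult mult.assoc)
    finally show ?thesis .
  qed
  moreover have "(\<lambda>n. \<Prod>i<k. \<Prod>j<n. 1 - a * q ^ i * (q ^ k) ^ j)
      \<longlonglongrightarrow> (\<Prod>i<k. qpochhammer_inf (a * q ^ i) (q ^ k))"
    using assms by (intro tendsto_prod LIMSEQ_qpochhammer_inf) (simp add: norm_power power_less_one_iff)
  moreover have "(\<lambda>n. \<Prod>j<n * k. 1 - a * q ^ j) \<longlonglongrightarrow> qpochhammer_inf a q"
    using LIMSEQ_qpochhammer_inf[OF assms(1), of a] \<open>k > 0\<close>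
    by (rule filterlim_compose[OF _ mult_nat_right_at_top])
  ultimately show ?thesis using LIMSEQ_unique by simp
qed

corollary qpochhammer_inf_dissect_2:
  assumes "norm q < 1"
  shows "qpochhammer_inf a q = qpochhammer_inf a (q\<^sup>2) * qpochhammer_inf (a * q) (q\<^sup>2)"
  using qpochhammer_inf_dissect[OF assms, of 2 a] by (simp add: numeral_2_eq_2)

corollary qpochhammer_inf_dissect_3:
  assumes "norm q < 1"
  shows "qpochhammer_inf a q = qpochhammer_inf a (q ^ 3) * qpochhammer_inf (a * q) (q ^ 3)
    * qpochhammer_inf (a * q\<^sup>2) (q ^ 3)"
  using qpochhammer_inf_dissect[OF assms, of 3 a] by (simp add: numeral_3_eq_3 power2_eq_square mult.assoc)

lemma prod_qpochhammer_inf_root_of_unity: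
  assumes "norm q < 1" and root: "\<And>x. (\<Prod>i<N. 1 - u ^ i * x) = 1 - x ^ N"
  shows "(\<Prod>i<N. qpochhammer_inf (u ^ i * a) q) = qpochhammer_inf (a ^ N) (q ^ N)"
proof -
  have "N > 0" using root[of 0] by (cases N) auto
  have "(\<Prod>i<N. \<Prod>j<n. 1 - u ^ i * a * q ^ j) = (\<Prod>j<n. 1 - a ^ N * (q ^ N) ^ j)" for n
  proof -
    have "(\<Prod>i<N. \<Prod>j<n. 1 - u ^ i * a * q ^ j) = (\<Prod>j<n. \<Prod>i<N. 1 - u ^ i * (a * q ^ j))"
      by (subst prod.swap) (simp add: mult.assoc)
    then show ?thesis
      by (simp add: root power_mult_distrib power_mult[symmetric] mult.commute)
  qed
  moreover have "(\<lambda>n. \<Prod>i<N. \<Prod>j<n. 1 - u ^ i * a * q ^ j) \<longlonglongrightarrow> (\<Prod>i<N. qpochhammer_inf (u ^ i * a) q)"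
    using assms by (intro tendsto_prod LIMSEQ_qpochhammer_inf)
  moreover have "(\<lambda>n. \<Prod>j<n. 1 - a ^ N * (q ^ N) ^ j) \<longlonglongrightarrow> qpochhammer_inf (a ^ N) (q ^ N)"
    using assms(1) \<open>N > 0\<close> by (intro LIMSEQ_qpochhammer_inf) (simp add: norm_power power_less_one_iff)
  ultimately show ?thesis using LIMSEQ_unique by simp
qed

corollary qpochhammer_inf_mult_uminus:
  assumes "norm q < 1"
  shows "qpochhammer_inf a q * qpochhammer_inf (- a) q = qpochhammer_inf (a\<^sup>2) (q\<^sup>2)"
  using prod_qpochhammer_inf_root_of_unity[OF assms, where N = 2 and u = "- 1" and a = a]
  by (simp add: numeral_2_eq_2 algebra_simps)

corollary qpochhammer_inf_mult_cube_roots: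
  assumes "norm q < 1" and \<omega>: "\<omega>\<^sup>2 + \<omega> + 1 = 0"
  shows "qpochhammer_inf a q * qpochhammer_inf (\<omega> * a) q * qpochhammer_inf (\<omega>\<^sup>2 * a) q
    = qpochhammer_inf (a ^ 3) (q ^ 3)"
proof -
  have "(1 - x) * (1 - \<omega> * x) * (1 - \<omega>\<^sup>2 * x) = 1 - x ^ 3" for x
    using \<omega> by algebra
  then show ?thesis
    using prod_qpochhammer_inf_root_of_unity[OF assms(1), where N = 3 and u = \<omega> and a = a]
    by (simp add: numeral_3_eq_3 power2_eq_square)
qed

definition nome :: "complex \<Rightarrow> bool" where
  "nome q \<longleftrightarrow> q \<noteq> 0 \<and> norm q < 1"

lemma nomeD: "nome q \<Longrightarrow> q \<noteq> 0" "nome q \<Longrightarrow> norm q < 1"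
  by (simp_all add: nome_def)

lemma nome_power: "nome q \<Longrightarrow> n > 0 \<Longrightarrow> nome (q ^ n)"
  by (simp add: nome_def norm_power power_less_one_iff)

lemma nome_uminus: "nome q \<Longrightarrow> nome (- q)"
  by (simp add: nome_def)

lemma nome_power_neq_1: "nome q \<Longrightarrow> n > 0 \<Longrightarrow> q ^ n \<noteq> 1"
  using nome_power[of q n] by (auto simp: nome_def)

lemma euler_prod_nonzero:
  assumes "nome q"
  shows "euler_prod q \<noteq> 0"
  unfolding qpochhammer_inf_def
proof (rule prodinf_nonzero)
  show "convergent_prod (\<lambda>j. 1 - q * q ^ j)"
    using nomeD[OF assms] by (intro convergent_prod_qpochhammer)
  show "1 - q * q ^ j \<noteq> 0" for j
    using nome_power_neq_1[OF assms, of "Suc j"] by simp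
qed

corollary euler_prod_power_nonzero: "nome q \<Longrightarrow> n > 0 \<Longrightarrow> euler_prod (q ^ n) \<noteq> 0"
  by (intro euler_prod_nonzero nome_power)

lemma qpochhammer_inf_uminus_self:
  assumes "nome q"
  shows "qpochhammer_inf (- q) q = euler_prod (q\<^sup>2) / euler_prod q"
  using qpochhammer_inf_mult_uminus[OF nomeD(2)[OF assms], of q] euler_prod_nonzero[OF assms]
  by (simp add: field_simps)

lemma qpochhammer_inf_uminus_square:
  assumes "nome q"
  shows "qpochhammer_inf (- q) (q\<^sup>2) = euler_prod (- q) / euler_prod (q\<^sup>2)"
  using qpochhammer_inf_dissect_2[of "- q" "- q"] nomeD[OF assms]
    euler_prod_power_nonzero[OF assms, of 2]
  by (simp add: field_simps power2_eq_square)

lemma euler_prod_mult_euler_prod_uminus: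
  assumes q: "nome q"
  shows "euler_prod q * euler_prod (- q) * euler_prod (q ^ 4) = euler_prod (q\<^sup>2) ^ 3"
proof -
  have "qpochhammer_inf (- q) q = qpochhammer_inf (- q) (q\<^sup>2) * qpochhammer_inf (- (q\<^sup>2)) (q\<^sup>2)"
    using qpochhammer_inf_dissect_2[OF nomeD(2)[OF q], of "- q"] by (simp add: power2_eq_square)
  moreover have "qpochhammer_inf (- (q\<^sup>2)) (q\<^sup>2) = euler_prod (q ^ 4) / euler_prod (q\<^sup>2)"
    using qpochhammer_inf_uminus_self[OF nome_power[OF q, of 2]] by (simp flip: power_mult)
  ultimately show ?thesis
    using euler_prod_nonzero[OF q] euler_prod_power_nonzero[OF q, of 2]
    unfolding qpochhammer_inf_uminus_self[OF q] qpochhammer_inf_uminus_square[OF q]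
    by (simp add: divide_simps) algebra
qed

section \<open>The theta series\<close>

definition tri :: "int \<Rightarrow> int" where
  "tri m = m * (m + 1) div 2"

lemma two_tri: "2 * tri m = m * (m + 1)"
  by (simp add: tri_def)

lemma tri_add: "tri (m + n) = tri m + tri n + m * n"
  using two_tri[of "m + n"] two_tri[of m] two_tri[of n] by (simp add: algebra_simps)

corollary tri_add_1: "tri (m + 1) = tri m + m + 1" and tri_diff_1: "tri (m - 1) = tri m - m"
  using tri_add[of m 1] tri_add[of m "- 1"] by (simp_all add: tri_def)

lemma tri_0 [simp]: "tri 0 = 0"
  by (simp add: tri_def)

lemma tri_reflect: "tri (- 1 - m) = tri m"
  using two_tri[of "- 1 - m"] two_tri[of m] by (simp add: algebra_simps)

definition jtheta :: "complex \<Rightarrow> complex \<Rightarrow> complex" where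
  "jtheta q z = (\<Sum>\<^sub>\<infinity>m. q powi tri m * z powi m)"

lemma summable_jtheta_nat:
  assumes "nome q"
  shows "summable (\<lambda>n. norm (q powi tri (int n) * z ^ n))"
proof -
  have "(\<lambda>n. norm q ^ Suc n * norm z) \<longlonglongrightarrow> 0 * norm z"
    using nomeD[OF assms] by (intro tendsto_mult[OF LIMSEQ_Suc[OF LIMSEQ_power_zero] tendsto_const]) auto
  then have "\<forall>\<^sub>F n in sequentially. norm q ^ Suc n * norm z < 1 / 2"
    by (rule order_tendstoD) auto
  then obtain N where N: "\<And>n. n \<ge> N \<Longrightarrow> norm q ^ Suc n * norm z < 1 / 2"
    by (auto simp: eventually_at_top_linorder)
  show ?thesis
  proof (rule summable_ratio_test[of "1 / 2" N])
    fix n assume "n \<ge> N"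
    have "q powi tri (int (Suc n)) = q powi tri (int n) * q powi int (Suc n)"
      using tri_add_1[of "int n"] nomeD(1)[OF assms]
      by (simp add: power_int_add add_ac flip: power_int_of_nat)
    then have "norm (q powi tri (int (Suc n)) * z ^ Suc n)
        = (norm q ^ Suc n * norm z) * norm (q powi tri (int n) * z ^ n)"
      by (simp only: norm_mult norm_power power_int_of_nat power_Suc mult_ac)
    also have "\<dots> \<le> 1 / 2 * norm (q powi tri (int n) * z ^ n)"
      using N[OF \<open>n \<ge> N\<close>] by (intro mult_right_mono) auto
    finally show "norm (norm (q powi tri (int (Suc n)) * z ^ Suc n))
        \<le> 1 / 2 * norm (norm (q powi tri (int n) * z ^ n))" by simp
  qed auto
qed

lemma has_sum_jtheta:
  assumes "nome q"
  shows "((\<lambda>m. q powi tri m * z powi m) has_sum jtheta q z) UNIV"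
proof -
  let ?f = "\<lambda>m. q powi tri m * z powi m"
  have nonneg: "?f summable_on range int"
    using summable_jtheta_nat[OF assms, of z]
    by (subst summable_on_reindex) (auto simp: o_def norm_summable_imp_summable_on)
  have "z powi (- 1 - int n) = inverse z * inverse z ^ n" for n
    by (simp add: power_int_def nat_add_distrib)
  moreover have "(\<lambda>n. inverse z * (q powi tri (int n) * inverse z ^ n)) summable_on UNIV"
    using summable_jtheta_nat[OF assms, of "inverse z"]
    by (intro summable_on_cmult_right norm_summable_imp_summable_on)
  ultimately have "(?f \<circ> (\<lambda>n. - 1 - int n)) summable_on UNIV"
    by (simp add: o_def mult_ac tri_reflect)
  then have neg: "?f summable_on range (\<lambda>n. - 1 - int n)"
    by (subst summable_on_reindex) (auto simp: inj_def)
  have "m \<in> range int \<union> range (\<lambda>n. - 1 - int n)" for m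
    by (cases "m \<ge> 0") (auto intro: range_eqI[of _ _ "nat m"] range_eqI[of _ _ "nat (- 1 - m)"])
  then have "range int \<union> range (\<lambda>n. - 1 - int n) = UNIV" by blast
  then have "?f summable_on UNIV"
    using summable_on_union[OF nonneg neg] by simp
  then show ?thesis unfolding jtheta_def by simp
qed

lemma has_sum_powi_tri_linear:
  assumes q: "nome q" and "a > 0" and e: "\<And>m. e m = int a * tri m + b * m"
  shows "((\<lambda>m. q powi e m) has_sum jtheta (q ^ a) (q powi b)) UNIV"
proof -
  have "q powi e m = (q ^ a) powi tri m * (q powi b) powi m" for m
    using nomeD[OF q] by (simp add: e power_int_add power_int_power flip: power_int_mult)
  then show ?thesis
    using has_sum_jtheta[OF nome_power[OF q \<open>a > 0\<close>], of "q powi b"] by simp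
qed

section \<open>The Jacobi triple product\<close>

definition qfact :: "complex \<Rightarrow> nat \<Rightarrow> complex" where
  "qfact q n = (\<Prod>i<n. 1 - q ^ Suc i)"

lemma qfact_nonzero: "nome q \<Longrightarrow> qfact q n \<noteq> 0"
  using nome_power_neq_1[of q "Suc _"] by (auto simp: qfact_def)

lemma LIMSEQ_qfact: "nome q \<Longrightarrow> qfact q \<longlonglongrightarrow> euler_prod q"
  using LIMSEQ_qpochhammer_inf[of q q] by (simp add: nomeD qfact_def[abs_def])

text \<open>The value \<open>0\<close> at negative integers makes the recurrences below hold without boundary cases.\<close>

definition inverse_qfact :: "complex \<Rightarrow> int \<Rightarrow> complex" where
  "inverse_qfact q k = (if k < 0 then 0 else inverse (qfact q (nat k)))"

lemma inverse_qfact_pred: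
  assumes "nome q"
  shows "inverse_qfact q (k - 1) = (1 - q powi k) * inverse_qfact q k"
proof (cases "k > 0")
  case True
  then obtain n where n: "k = int (Suc n)" by (metis pos_int_cases gr0_implies_Suc)
  have "qfact q (Suc n) = qfact q n * (1 - q powi k)"
    unfolding n power_int_of_nat by (simp add: qfact_def)
  then show ?thesis
    using qfact_nonzero[OF assms, of n] qfact_nonzero[OF assms, of "Suc n"]
    by (simp add: inverse_qfact_def n nat_add_distrib field_simps)
qed (auto simp: inverse_qfact_def)

definition central_qbinomial :: "complex \<Rightarrow> nat \<Rightarrow> int \<Rightarrow> complex" where
  "central_qbinomial q n m = qfact q (2 * n) * inverse_qfact q (int n + m) * inverse_qfact q (int n - m)"

lemma central_qbinomial_Suc:
  assumes q: "nome q"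
  shows "central_qbinomial q (Suc n) m = (1 + q powi (2 * int n + 1)) * central_qbinomial q n m
    + q powi (int n + 1 - m) * central_qbinomial q n (m - 1)
    + q powi (int n + 1 + m) * central_qbinomial q n (m + 1)"
proof -
  define A B where "A = q powi (int n + m)" and "B = q powi (int n - m)"
  define x y where "x = inverse_qfact q (int n + m + 1)" and "y = inverse_qfact q (int n - m + 1)"
  note pred = inverse_qfact_pred[OF q]
  have AB: "q powi (2 * int n) = A * B" "q ^ (2 * n) = A * B"
    using nomeD(1)[OF q] power_int_of_nat[of q "2 * n"]
    by (simp_all add: A_def B_def flip: power_int_add del: power_int_of_nat)
  have powers: "q powi (2 * int n + 1) = q * A * B" "q powi (int n + 1 - m) = q * B"
    "q powi (int n + 1 + m) = q * A" "q powi (int n + m + 1) = q * A" "q powi (int n - m + 1) = q * B"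
    "q ^ (2 * n + 1) = q * A * B" "q ^ (2 * n + 2) = q\<^sup>2 * A * B"
    using nomeD(1)[OF q] AB
    by (simp_all add: A_def B_def power_int_add power_int_diff power_add power2_eq_square)
  have once: "inverse_qfact q (int n + m) = (1 - q * A) * x" "inverse_qfact q (int n - m) = (1 - q * B) * y"
    using pred[of "int n + m + 1"] pred[of "int n - m + 1"] by (simp_all add: x_def y_def powers)
  then have twice: "inverse_qfact q (int n + (m - 1)) = (1 - A) * ((1 - q * A) * x)"
    "inverse_qfact q (int n - (m + 1)) = (1 - B) * ((1 - q * B) * y)"
    using pred[of "int n + m"] pred[of "int n - m"]
    by (simp_all add: A_def B_def add_diff_eq flip: diff_diff_eq)
  have "qfact q (2 * Suc n) = qfact q (2 * n) * (1 - q ^ (2 * n + 1)) * (1 - q ^ (2 * n + 2))"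
    by (simp add: qfact_def)
  moreover have "inverse_qfact q (int n - (m - 1)) = y" "inverse_qfact q (int n + (m + 1)) = x"
    "inverse_qfact q (int (Suc n) + m) = x" "inverse_qfact q (int (Suc n) - m) = y"
    by (simp_all add: x_def y_def algebra_simps)
  moreover have "(1 - q * A * B) * (1 - q\<^sup>2 * A * B) = (1 + q * A * B) * (1 - q * A) * (1 - q * B)
      + q * B * (1 - A) * (1 - q * A) + q * A * (1 - B) * (1 - q * B)"
    by algebra
  ultimately show ?thesis
    using once twice unfolding central_qbinomial_def powers by algebra
qed

lemma jtheta_term_shift:
  assumes "nome q" "z \<noteq> 0"
  shows "z * q ^ Suc n * (q powi tri (m - 1) * z powi (m - 1)) = q powi (int n + 1 - m) * (q powi tri m * z powi m)"
    and "inverse z * q ^ n * (q powi tri (m + 1) * z powi (m + 1)) = q powi (int n + 1 + m) * (q powi tri m * z powi m)"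
  using nomeD(1)[OF assms(1)] assms(2)
  by (simp_all add: tri_diff_1 tri_add_1 power_int_add power_int_diff)

lemma finite_jacobi_triple_product:
  assumes q: "nome q" and z: "z \<noteq> 0"
  shows "((\<lambda>m. central_qbinomial q n m * (q powi tri m * z powi m)) has_sum
    (\<Prod>i<n. (1 + z * q ^ Suc i) * (1 + inverse z * q ^ i))) UNIV"
proof (induction n)
  case 0
  have "central_qbinomial q 0 m = of_bool (m = 0)" for m
    by (auto simp: central_qbinomial_def inverse_qfact_def qfact_def)
  then show ?case
    by (intro has_sum_finite_neutralI[of "{0}"]) auto
next
  case (Suc n)
  let ?t = "\<lambda>m. q powi tri m * z powi m" and ?c = "central_qbinomial q n"
  define P where "P = (\<Prod>i<n. (1 + z * q ^ Suc i) * (1 + inverse z * q ^ i))"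
  have shift: "((\<lambda>m. ?c (m + k) * ?t (m + k)) has_sum P) UNIV" for k
    using Suc.IH has_sum_reindex_bij_betw[of "\<lambda>m. m + k" UNIV UNIV "\<lambda>m. ?c m * ?t m" P]
    by (simp add: P_def bij_plus_right)
  have "(1 + z * q ^ Suc n) * (1 + inverse z * q ^ n)
      = 1 + q powi (2 * int n + 1) + z * q ^ Suc n + inverse z * q ^ n"
    using nomeD[OF q] z
    by (simp add: power_int_add power_int_mult power2_eq_square field_simps flip: power_mult_distrib)
  then have "(\<Prod>i<Suc n. (1 + z * q ^ Suc i) * (1 + inverse z * q ^ i))
      = (1 + q powi (2 * int n + 1)) * P + z * q ^ Suc n * P + inverse z * q ^ n * P"
    unfolding prod.lessThan_Suc P_def[symmetric] by (simp only: distrib_left distrib_right mult_ac mult_1)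
  moreover have "((\<lambda>m. (1 + q powi (2 * int n + 1)) * (?c m * ?t m)
        + z * q ^ Suc n * (?c (m - 1) * ?t (m - 1)) + inverse z * q ^ n * (?c (m + 1) * ?t (m + 1))) has_sum
      (1 + q powi (2 * int n + 1)) * P + z * q ^ Suc n * P + inverse z * q ^ n * P) UNIV"
    using shift[of 0] shift[of 1] shift[of "- 1"] by (intro has_sum_add has_sum_cmult_right) simp_all
  moreover have "(1 + q powi (2 * int n + 1)) * (?c m * ?t m) + z * q ^ Suc n * (?c (m - 1) * ?t (m - 1))
      + inverse z * q ^ n * (?c (m + 1) * ?t (m + 1)) = central_qbinomial q (Suc n) m * ?t m" for m
  proof -
    have "z * q ^ Suc n * (?c (m - 1) * ?t (m - 1)) = ?c (m - 1) * (z * q ^ Suc n * ?t (m - 1))"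
      "inverse z * q ^ n * (?c (m + 1) * ?t (m + 1)) = ?c (m + 1) * (inverse z * q ^ n * ?t (m + 1))"
      by (simp_all only: mult_ac)
    then show ?thesis
      unfolding jtheta_term_shift[OF q z] central_qbinomial_Suc[OF q] by (simp only: ring_distribs mult_ac)
  qed
  ultimately show ?case by (simp only:)
qed

lemma LIMSEQ_inverse_qfact:
  assumes "nome q"
  shows "(\<lambda>n. inverse (qfact q n)) \<longlonglongrightarrow> inverse (euler_prod q)"
  using LIMSEQ_qfact[OF assms] euler_prod_nonzero[OF assms] by (rule tendsto_inverse)

lemma LIMSEQ_central_qbinomial:
  assumes q: "nome q"
  shows "(\<lambda>n. central_qbinomial q n m) \<longlonglongrightarrow> 1 / euler_prod q"
proof -
  have "filterlim (\<lambda>n. nat (int n + k)) sequentially sequentially" for k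
    unfolding filterlim_at_top
  proof
    show "\<forall>\<^sub>F n in sequentially. Z \<le> nat (int n + k)" for Z
      by (rule eventually_sequentiallyI[of "Z + nat \<bar>k\<bar>"]) linarith
  qed
  then have "(\<lambda>n. inverse (qfact q (nat (int n + k)))) \<longlonglongrightarrow> inverse (euler_prod q)" for k
    by (rule filterlim_compose[OF LIMSEQ_inverse_qfact[OF q]])
  moreover have "\<forall>\<^sub>F n in sequentially. inverse (qfact q (nat (int n + k))) = inverse_qfact q (int n + k)"
    for k
    by (rule eventually_sequentiallyI[of "nat \<bar>k\<bar>"]) (auto simp: inverse_qfact_def)
  ultimately have "(\<lambda>n. inverse_qfact q (int n + k)) \<longlonglongrightarrow> inverse (euler_prod q)" for k
    by (rule Lim_transform_eventually)
  from this[of m] this[of "- m"]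
  have "(\<lambda>n. central_qbinomial q n m) \<longlonglongrightarrow> euler_prod q * inverse (euler_prod q) * inverse (euler_prod q)"
    unfolding central_qbinomial_def
    by (intro tendsto_mult filterlim_compose[OF LIMSEQ_qfact[OF q] mult_nat_left_at_top]) simp_all
  then show ?thesis
    using euler_prod_nonzero[OF q] by (simp add: field_simps)
qed

lemma norm_central_qbinomial_bounded:
  assumes q: "nome q"
  obtains K where "\<And>n m. norm (central_qbinomial q n m) \<le> K"
proof -
  obtain K where K: "\<And>n. norm (qfact q n) \<le> K"
    using convergent_imp_Bseq[OF convergentI[OF LIMSEQ_qfact[OF q]]] by (auto simp: Bseq_def)
  obtain L where L: "\<And>n. norm (inverse (qfact q n)) \<le> L" "L > 0"
    using convergent_imp_Bseq[OF convergentI[OF LIMSEQ_inverse_qfact[OF q]]] by (auto simp: Bseq_def)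
  then have "norm (inverse_qfact q k) \<le> L" for k
    by (simp add: inverse_qfact_def less_imp_le)
  then have "norm (central_qbinomial q n m) \<le> K * L * L" for n m
    unfolding central_qbinomial_def norm_mult
    using K L order_trans[OF norm_ge_zero K] by (intro mult_mono) auto
  then show ?thesis by (rule that)
qed

theorem jacobi_triple_product:
  assumes q: "nome q" and z: "z \<noteq> 0"
  shows "jtheta q z = euler_prod q * qpochhammer_inf (- z * q) q * qpochhammer_inf (- inverse z) q"
proof -
  let ?t = "\<lambda>m. q powi tri m * z powi m"
  let ?P = "\<lambda>n. (\<Prod>i<n. (1 + z * q ^ Suc i) * (1 + inverse z * q ^ i))"
  obtain K where K: "\<And>n m. norm (central_qbinomial q n m) \<le> K"
    using norm_central_qbinomial_bounded[OF q] by blast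
  have "(\<lambda>m. norm (?t m)) summable_on UNIV"
    using has_sum_jtheta[OF q, of z]
    by (auto dest: has_sum_imp_summable simp: summable_on_iff_abs_summable_on_complex)
  then have "(\<lambda>n. \<Sum>\<^sub>\<infinity>m. central_qbinomial q n m * ?t m) \<longlonglongrightarrow> (\<Sum>\<^sub>\<infinity>m. 1 / euler_prod q * ?t m)"
    by (intro infsum_dominated_convergence[where h = "\<lambda>m. K * norm (?t m)"] summable_on_cmult_right
        tendsto_mult LIMSEQ_central_qbinomial[OF q] tendsto_const)
       (auto simp: norm_mult intro!: mult_mono mult_nonneg_nonneg order_trans[OF norm_ge_zero K] K)
  then have "?P \<longlonglongrightarrow> 1 / euler_prod q * jtheta q z"
    by (simp only: infsumI[OF finite_jacobi_triple_product[OF q z]] jtheta_def infsum_cmult_right')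
  moreover have "?P \<longlonglongrightarrow> qpochhammer_inf (- z * q) q * qpochhammer_inf (- inverse z) q"
    using tendsto_mult[OF LIMSEQ_qpochhammer_inf[of q "- z * q"] LIMSEQ_qpochhammer_inf[of q "- inverse z"]]
      nomeD[OF q]
    by (simp add: prod.distrib mult.assoc)
  ultimately have "1 / euler_prod q * jtheta q z
      = qpochhammer_inf (- z * q) q * qpochhammer_inf (- inverse z) q"
    by (rule LIMSEQ_unique)
  then show ?thesis using euler_prod_nonzero[OF q] by (simp add: field_simps)
qed

section \<open>Frobenius symbols and the constant term of a theta power\<close>

definition colored_sets :: "nat \<Rightarrow> (nat \<times> nat) set set" where
  "colored_sets k = Fpow (UNIV \<times> {1..k})"

lemma frobenius_row_distinct: "frobenius_row k r \<Longrightarrow> distinct r"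
  unfolding frobenius_row_def by (induction r) (auto simp: colored_less_def)

lemma bij_betw_set_frobenius_row: "bij_betw set {r. frobenius_row k r} (colored_sets k)"
proof -
  interpret colored: linorder "\<lambda>x y. x = y \<or> colored_less x y" colored_less
    by standard (auto simp: colored_less_def prod_eq_iff)
  show ?thesis
  proof (rule bij_betwI[where g = "\<lambda>X. rev (colored.sorted_list_of_set X)"])
    show "set \<in> {r. frobenius_row k r} \<rightarrow> colored_sets k"
      by (auto simp: frobenius_row_def colored_sets_def Fpow_def)
    show "(\<lambda>X. rev (colored.sorted_list_of_set X)) \<in> colored_sets k \<rightarrow> {r. frobenius_row k r}"
      by (auto simp: frobenius_row_def colored_sets_def Fpow_def sorted_wrt_rev)
    show "set (rev (colored.sorted_list_of_set X)) = X" if "X \<in> colored_sets k" for X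
      using that by (simp add: colored_sets_def Fpow_def)
    show "rev (colored.sorted_list_of_set (set r)) = r" if "r \<in> {r. frobenius_row k r}" for r
    proof -
      have "sorted_wrt colored_less (rev r)"
        using that by (simp add: frobenius_row_def sorted_wrt_rev)
      then have "colored.sorted_list_of_set (set r) = rev r"
        by (intro colored.strict_sorted_equal) simp_all
      then show ?thesis by simp
    qed
  qed
qed

lemma has_sum_colored_sets_prod:
  assumes q: "norm q < 1"
  shows "((\<lambda>X. \<Prod>i\<in>X. y * q ^ fst i) has_sum qpochhammer_inf (- y) q ^ k) (colored_sets k)"
  unfolding colored_sets_def
proof (rule has_sum_Fpow_prod[where A = "\<lambda>n. {..<n} \<times> {1..k}"])
  have "summable (\<lambda>l. norm (y * q ^ l))"
    using q by (simp add: norm_mult norm_power summable_mult summable_geometric)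
  then have levels: "(\<lambda>l. y * q ^ l) summable_on UNIV"
    by (rule norm_summable_imp_summable_on)
  have colors: "((\<lambda>c. 1 :: complex) has_sum of_nat k) {1..k}"
    by (rule has_sum_finiteI) auto
  from has_sum_imp_summable[OF has_sum_times[OF has_sum_infsum[OF levels] colors]]
  show "(\<lambda>i. norm (y * q ^ fst i)) summable_on UNIV \<times> {1..k}"
    by (simp add: case_prod_unfold summable_on_iff_abs_summable_on_complex)
  have "(\<Prod>i\<in>{..<n} \<times> {1..k}. 1 + y * q ^ fst i) = (\<Prod>j<n. 1 - (- y) * q ^ j) ^ k" for n
    using prod.cartesian_product[of "\<lambda>j c. 1 + y * q ^ j" "{1..k}" "{..<n}"]
    by (simp add: case_prod_unfold prod_power_distrib)
  then show "(\<lambda>n. \<Prod>i\<in>{..<n} \<times> {1..k}. 1 + y * q ^ fst i) \<longlonglongrightarrow> qpochhammer_inf (- y) q ^ k"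
    using tendsto_power[OF LIMSEQ_qpochhammer_inf[OF q, of "- y"]] by simp
qed (auto simp: incseq_def)

definition pair_weight :: "complex \<Rightarrow> (nat \<times> nat) set \<times> (nat \<times> nat) set \<Rightarrow> complex" where
  "pair_weight q = (\<lambda>(X, Y). q ^ (card X + sum fst X + sum fst Y))"

definition pair_degree :: "'a set \<times> 'a set \<Rightarrow> int" where
  "pair_degree = (\<lambda>(X, Y). int (card X) - int (card Y))"

lemma has_sum_pair_weight:
  assumes q: "norm q < 1" and z: "z \<noteq> 0"
  shows "((\<lambda>s. pair_weight q s * z powi pair_degree s) has_sum
      (qpochhammer_inf (- z * q) q * qpochhammer_inf (- inverse z) q) ^ k) (colored_sets k \<times> colored_sets k)"
proof -
  have "((\<lambda>(X, Y). (\<Prod>i\<in>X. z * q * q ^ fst i) * (\<Prod>i\<in>Y. inverse z * q ^ fst i)) has_sum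
      qpochhammer_inf (- (z * q)) q ^ k * qpochhammer_inf (- inverse z) q ^ k)
      (colored_sets k \<times> colored_sets k)"
    by (intro has_sum_times has_sum_colored_sets_prod q)
  moreover have "(\<Prod>i\<in>X. z * q * q ^ fst i) * (\<Prod>i\<in>Y. inverse z * q ^ fst i)
      = pair_weight q (X, Y) * z powi pair_degree (X, Y)" for X Y :: "(nat \<times> nat) set"
    using z by (simp add: pair_weight_def pair_degree_def prod.distrib power_add power_mult_distrib
        power_sum power_int_diff divide_inverse power_inverse mult_ac)
  ultimately show ?thesis by (simp add: case_prod_unfold power_mult_distrib)
qed

lemma bij_betw_set_frobenius_symbol:
  "bij_betw (map_prod set set) {s. frobenius_symbol k s}
    {s \<in> colored_sets k \<times> colored_sets k. pair_degree s = 0}"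
proof -
  let ?R = "{r. frobenius_row k r}"
  have bij: "bij_betw (map_prod set set) (?R \<times> ?R) (colored_sets k \<times> colored_sets k)"
    by (intro bij_betw_map_prod bij_betw_set_frobenius_row)
  have "frobenius_symbol k s \<longleftrightarrow> s \<in> ?R \<times> ?R \<and> pair_degree (map_prod set set s) = 0" for s
    using frobenius_row_distinct[of k, THEN distinct_card]
    by (cases s) (auto simp: frobenius_symbol_def pair_degree_def)
  then have "{s. frobenius_symbol k s} = {s \<in> ?R \<times> ?R. pair_degree (map_prod set set s) = 0}"
    by blast
  then show ?thesis
    by (simp only:) (rule bij_betw_Collect[OF bij refl])
qed

lemma pair_weight_frobenius_symbol:
  assumes "frobenius_symbol k s"
  shows "pair_weight q (map_prod set set s) = q ^ frobenius_weight s"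
proof (cases s)
  case (Pair r r')
  then have "distinct r" "distinct r'"
    using assms frobenius_row_distinct by (auto simp: frobenius_symbol_def)
  then show ?thesis
    by (simp add: Pair pair_weight_def frobenius_weight_def distinct_card sum_list_distinct_conv_sum_set)
qed

lemma CPhi_sums:
  assumes q: "norm q < 1"
  shows "(\<lambda>n. of_nat (cphi k n) * q ^ n) sums
    infsum (pair_weight q) {s \<in> colored_sets k \<times> colored_sets k. pair_degree s = 0}" (is "_ sums ?I")
proof (rule has_sum_imp_sums, rule has_sum_SigmaD)
  have "pair_weight q summable_on colored_sets k \<times> colored_sets k"
    using has_sum_pair_weight[OF q, of 1 k] by (auto dest: has_sum_imp_summable)
  then have "(pair_weight q has_sum ?I) {s \<in> colored_sets k \<times> colored_sets k. pair_degree s = 0}"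
    by (intro has_sum_infsum, elim summable_on_subset_banach) auto
  then have "((\<lambda>s. pair_weight q (map_prod set set s)) has_sum ?I) {s. frobenius_symbol k s}"
    by (simp only: has_sum_reindex_bij_betw[OF bij_betw_set_frobenius_symbol])
  then have "((\<lambda>s. q ^ frobenius_weight s) has_sum ?I) {s. frobenius_symbol k s}"
    by (rule has_sum_cong[THEN iffD1, rotated]) (simp add: pair_weight_frobenius_symbol)
  then show "((\<lambda>p. q ^ fst p) has_sum ?I) (Sigma UNIV (frobenius_partitions k))"
    by (rule has_sum_reindex_bij_witness[of _ snd "\<lambda>s. (frobenius_weight s, s)", THEN iffD1, rotated -1])
       (auto simp: frobenius_partitions_def)
  show "((\<lambda>s. q ^ fst (n, s)) has_sum of_nat (cphi k n) * q ^ n) (frobenius_partitions k n)" for n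
    by (rule has_sum_finiteI) (auto simp: finite_frobenius_partitions cphi_def)
qed

theorem CPhi_eq_constant_term:
  fixes w :: "'a \<Rightarrow> complex" and d :: "'a \<Rightarrow> int"
  assumes q: "nome q"
    and expansion: "\<And>z. norm z = 1 \<Longrightarrow> ((\<lambda>s. w s * z powi d s) has_sum jtheta q z ^ k) S"
  shows "euler_prod q ^ k * CPhi k q = infsum w {s \<in> S. d s = 0}"
proof -
  let ?S = "colored_sets k \<times> colored_sets k"
  have "((\<lambda>s. euler_prod q ^ k * pair_weight q s * z powi pair_degree s) has_sum jtheta q z ^ k) ?S"
    if "norm z = 1" for z
  proof -
    have "z \<noteq> 0" using that by auto
    from has_sum_cmult_right[OF has_sum_pair_weight[OF nomeD(2)[OF q] this], of "euler_prod q ^ k" k]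
    show ?thesis
      by (simp add: jacobi_triple_product[OF q \<open>z \<noteq> 0\<close>] power_mult_distrib mult.assoc)
  qed
  from constant_term_unique[OF this expansion]
  have "(\<Sum>\<^sub>\<infinity>s\<in>{s \<in> ?S. pair_degree s = 0}. euler_prod q ^ k * pair_weight q s) = infsum w {s \<in> S. d s = 0}"
    by simp
  moreover have "CPhi k q = infsum (pair_weight q) {s \<in> ?S. pair_degree s = 0}"
    using CPhi_sums[OF nomeD(2)[OF q]] unfolding CPhi_def by (rule sums_unique[symmetric])
  ultimately show ?thesis by (simp add: infsum_cmult_right')
qed

section \<open>The theta series of the hexagonal lattice\<close>

definition hex_norm :: "int \<Rightarrow> int \<Rightarrow> int" where
  "hex_norm b c = b * b + b * c + c * c"

definition hex_term :: "complex \<Rightarrow> complex \<Rightarrow> complex \<Rightarrow> int \<times> int \<Rightarrow> complex" where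
  "hex_term q u v = (\<lambda>(b, c). q powi hex_norm b c * u powi b * v powi c)"

definition hex_theta :: "complex \<Rightarrow> complex \<Rightarrow> complex \<Rightarrow> complex" where
  "hex_theta q u v = infsum (hex_term q u v) UNIV"

lemma hex_term_powi:
  assumes "nome q"
  shows "hex_term (q ^ a) (q powi s) (q powi t) (b, c) = q powi (int a * hex_norm b c + s * b + t * c)"
  using nomeD(1)[OF assms] by (simp add: hex_term_def power_int_add power_int_power flip: power_int_mult)

lemma has_sum_three_jtheta:
  assumes q: "nome q" and nonzero: "z \<noteq> 0" "u \<noteq> 0" "v \<noteq> 0"
  shows "((\<lambda>(j, p). q powi tri j * hex_term q (u * q powi (- j)) (v * q powi (- j)) p * z powi j) has_sum
    jtheta q z * jtheta q (u * z) * jtheta q (v * z)) UNIV"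
proof -
  let ?t = "\<lambda>z m. q powi tri m * z powi m"
  have "((\<lambda>(a, b, c). ?t z a * (?t (u * z) b * ?t (v * z) c)) has_sum
      jtheta q z * (jtheta q (u * z) * jtheta q (v * z))) UNIV"
    using has_sum_times[OF has_sum_jtheta[OF q] has_sum_times[OF has_sum_jtheta[OF q] has_sum_jtheta[OF q]]]
    by (simp add: case_prod_unfold)
  moreover have "?t z a * (?t (u * z) b * ?t (v * z) c) = q powi tri (a + b + c)
      * hex_term q (u * q powi (- (a + b + c))) (v * q powi (- (a + b + c))) (b, c) * z powi (a + b + c)"
    for a b c
  proof -
    have "tri a + tri b + tri c = tri (a + b + c) + hex_norm b c + - (a + b + c) * b + - (a + b + c) * c"
      using two_tri[of "a + b + c"] two_tri[of a] two_tri[of b] two_tri[of c]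
      by (simp add: hex_norm_def algebra_simps)
    then have "q powi tri a * q powi tri b * q powi tri c = q powi tri (a + b + c) * q powi hex_norm b c
        * q powi (- (a + b + c) * b) * q powi (- (a + b + c) * c)"
      using nomeD(1)[OF q] by (simp flip: power_int_add)
    moreover have "z powi (a + b + c) = z powi a * z powi b * z powi c"
      using nonzero by (simp add: power_int_add)
    ultimately show ?thesis
      unfolding hex_term_def prod.case power_int_mult_distrib power_int_mult[symmetric] by algebra
  qed
  ultimately show ?thesis
    by (elim has_sum_reindex_bij_witness[of _ "\<lambda>(j, b, c). (j - b - c, b, c)" "\<lambda>(a, b, c). (a + b + c, b, c)",
          THEN iffD1, rotated -1]) (simp_all split: prod.splits)
qed

lemma has_sum_hex_theta:
  assumes q: "nome q" and nonzero: "u \<noteq> 0" "v \<noteq> 0"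
  shows "(hex_term q u v has_sum hex_theta q u v) UNIV"
proof -
  from has_sum_imp_summable[OF has_sum_three_jtheta[OF q _ nonzero, of 1]]
  have "(\<lambda>(j, p). q powi tri j * hex_term q (u * q powi (- j)) (v * q powi (- j)) p) summable_on UNIV \<times> UNIV"
    by simp
  from summable_on_SigmaD1[OF this, of 0] show ?thesis
    unfolding hex_theta_def by simp
qed

lemma has_sum_three_jtheta_laurent:
  assumes q: "nome q" and nonzero: "z \<noteq> 0" "u \<noteq> 0" "v \<noteq> 0"
  shows "((\<lambda>j. q powi tri j * hex_theta q (u * q powi (- j)) (v * q powi (- j)) * z powi j) has_sum
    jtheta q z * jtheta q (u * z) * jtheta q (v * z)) UNIV"
proof (rule has_sum_SigmaD)
  let ?f = "\<lambda>(j, p). q powi tri j * hex_term q (u * q powi (- j)) (v * q powi (- j)) p * z powi j"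
  show "(?f has_sum jtheta q z * jtheta q (u * z) * jtheta q (v * z)) (UNIV \<times> UNIV)"
    using has_sum_three_jtheta[OF assms] by simp
  have "(hex_term q (u * q powi (- j)) (v * q powi (- j)) has_sum
      hex_theta q (u * q powi (- j)) (v * q powi (- j))) UNIV" for j
    using nomeD(1)[OF q] nonzero by (intro has_sum_hex_theta[OF q]) simp_all
  from has_sum_cmult_left[OF has_sum_cmult_right[OF this]]
  show "((\<lambda>p. ?f (j, p)) has_sum
      q powi tri j * hex_theta q (u * q powi (- j)) (v * q powi (- j)) * z powi j) UNIV" for j
    by simp
qed

lemma hex_theta_eqI:
  assumes q: "nome q" and p: "nome p" and nonzero: "u \<noteq> 0" "v \<noteq> 0" and "r > 0"
    and product: "\<And>z. z \<noteq> 0 \<Longrightarrow> jtheta q z * jtheta q (u * z) * jtheta q (v * z) = K * jtheta p (z ^ r)"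
  shows "hex_theta q u v = K"
proof -
  have "infsum (\<lambda>j. q powi tri j * hex_theta q (u * q powi (- j)) (v * q powi (- j))) {j \<in> UNIV. j = 0}
      = infsum (\<lambda>m. K * p powi tri m) {m \<in> UNIV. int r * m = 0}"
  proof (rule constant_term_unique[where f = "\<lambda>z. K * jtheta p (z ^ r)"])
    fix z :: complex assume "norm z = 1"
    then have "z \<noteq> 0" by auto
    show "((\<lambda>j. q powi tri j * hex_theta q (u * q powi (- j)) (v * q powi (- j)) * z powi j) has_sum
        K * jtheta p (z ^ r)) UNIV"
      using has_sum_three_jtheta_laurent[OF q \<open>z \<noteq> 0\<close> nonzero] by (simp add: product[OF \<open>z \<noteq> 0\<close>])
    show "((\<lambda>m. K * p powi tri m * z powi (int r * m)) has_sum K * jtheta p (z ^ r)) UNIV"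
      using has_sum_cmult_right[OF has_sum_jtheta[OF p, of "z ^ r"], of K]
      by (simp add: power_int_power mult.assoc)
  qed
  then show ?thesis using \<open>r > 0\<close> by simp
qed

lemma hex_theta_inverse: "hex_theta q (inverse u) (inverse v) = hex_theta q u v"
  unfolding hex_theta_def
  by (rule infsum_reindex_bij_witness[of _ "\<lambda>(b, c). (- b, - c)" "\<lambda>(b, c). (- b, - c)"])
     (auto simp: hex_term_def hex_norm_def power_int_minus power_int_inverse)

lemma hex_theta_shift:
  assumes q: "nome q" and nonzero: "u \<noteq> 0" "v \<noteq> 0"
  shows "hex_theta q u v
    = q powi (3 * s * s) * (u * v) powi s * hex_theta q (u * q powi (3 * s)) (v * q powi (3 * s))"
proof -
  let ?K = "q powi (3 * s * s) * (u * v) powi s"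
  have "hex_term q u v (b + s, c + s) = ?K * hex_term q (u * q powi (3 * s)) (v * q powi (3 * s)) (b, c)"
    for b c
  proof -
    have "hex_norm (b + s) (c + s) = 3 * s * s + hex_norm b c + 3 * s * b + 3 * s * c"
      by (simp add: hex_norm_def algebra_simps)
    then show ?thesis
      using nomeD(1)[OF q] nonzero unfolding hex_term_def prod.case
      by (simp only: simp_thms power_int_add power_int_mult_distrib power_int_mult[symmetric])
         (simp only: mult_ac)
  qed
  then have "(\<Sum>\<^sub>\<infinity>p. ?K * hex_term q (u * q powi (3 * s)) (v * q powi (3 * s)) p) = hex_theta q u v"
    unfolding hex_theta_def
    by (intro infsum_reindex_bij_witness[of _ "\<lambda>(b, c). (b - s, c - s)" "\<lambda>(b, c). (b + s, c + s)"]) auto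
  then show ?thesis
    by (simp add: hex_theta_def infsum_cmult_right')
qed

text \<open>The cubic theta functions of the Borweins are \<open>cubic_b q\<close> and \<open>3 q\<^bsup>1/3\<^esup> cubic_c q\<close>.\<close>

definition cubic_b :: "complex \<Rightarrow> complex" where
  "cubic_b q = euler_prod q ^ 3 / euler_prod (q ^ 3)"

definition cubic_c :: "complex \<Rightarrow> complex" where
  "cubic_c q = euler_prod (q ^ 3) ^ 3 / euler_prod q"

lemma hex_theta_cube_roots:
  assumes q: "nome q" and \<omega>: "\<omega>\<^sup>2 + \<omega> + 1 = 0"
  shows "hex_theta q \<omega> (\<omega>\<^sup>2) = cubic_b q"
proof (rule hex_theta_eqI[OF q nome_power[OF q, of 3]])
  have "\<omega> ^ 3 = 1" using \<omega> by algebra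
  then show "\<omega> \<noteq> 0" "\<omega>\<^sup>2 \<noteq> 0" by auto
  fix z :: complex assume z: "z \<noteq> 0"
  then have nonzero: "\<omega> * z \<noteq> 0" "\<omega>\<^sup>2 * z \<noteq> 0" "z ^ 3 \<noteq> 0"
    using \<open>\<omega> \<noteq> 0\<close> by simp_all
  have inverses: "inverse (\<omega> * z) = \<omega>\<^sup>2 * inverse z" "inverse (\<omega>\<^sup>2 * z) = \<omega> * inverse z"
    using \<open>\<omega> ^ 3 = 1\<close> \<open>\<omega> \<noteq> 0\<close> z by (simp_all add: field_simps power2_eq_square power3_eq_cube)
  have plus: "qpochhammer_inf (- (z ^ 3) * q ^ 3) (q ^ 3) = qpochhammer_inf (- z * q) q
      * qpochhammer_inf (- (\<omega> * z) * q) q * qpochhammer_inf (- (\<omega>\<^sup>2 * z) * q) q"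
    using qpochhammer_inf_mult_cube_roots[OF nomeD(2)[OF q] \<omega>, of "- z * q"]
    by (simp add: power_mult_distrib mult.assoc)
  have minus: "qpochhammer_inf (- inverse (z ^ 3)) (q ^ 3) = qpochhammer_inf (- inverse z) q
      * qpochhammer_inf (- (\<omega> * inverse z)) q * qpochhammer_inf (- (\<omega>\<^sup>2 * inverse z)) q"
    using qpochhammer_inf_mult_cube_roots[OF nomeD(2)[OF q] \<omega>, of "- inverse z"] by (simp add: power_inverse)
  have "jtheta q z * jtheta q (\<omega> * z) * jtheta q (\<omega>\<^sup>2 * z)
      = euler_prod q ^ 3 * qpochhammer_inf (- (z ^ 3) * q ^ 3) (q ^ 3)
        * qpochhammer_inf (- inverse (z ^ 3)) (q ^ 3)"
    unfolding jacobi_triple_product[OF q z] jacobi_triple_product[OF q nonzero(1)]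
      jacobi_triple_product[OF q nonzero(2)] inverses plus minus by algebra
  then show "jtheta q z * jtheta q (\<omega> * z) * jtheta q (\<omega>\<^sup>2 * z) = cubic_b q * jtheta (q ^ 3) (z ^ 3)"
    using jacobi_triple_product[OF nome_power[OF q, of 3] nonzero(3)]
      euler_prod_power_nonzero[OF q, of 3]
    by (simp add: cubic_b_def)
qed (use q in \<open>simp_all add: nome_power\<close>)

lemma hex_theta_third_coset:
  assumes q: "nome q"
  shows "hex_theta (q ^ 3) (q powi (- 1)) (q powi (- 2)) = cubic_c q"
proof (rule hex_theta_eqI[OF nome_power[OF q, of 3] q, where r = 1])
  note triple_product = jacobi_triple_product[OF nome_power[OF q, of 3, simplified]]
  show "q powi (- 1) \<noteq> 0" "q powi (- 2) \<noteq> 0"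
    using nomeD(1)[OF q] by simp_all
  fix z :: complex assume z: "z \<noteq> 0"
  have plus: "qpochhammer_inf (- z * q) q = qpochhammer_inf (- z * q) (q ^ 3)
      * qpochhammer_inf (- z * q\<^sup>2) (q ^ 3) * qpochhammer_inf (- z * q ^ 3) (q ^ 3)"
    using qpochhammer_inf_dissect_3[OF nomeD(2)[OF q], of "- z * q"]
    by (simp add: power2_eq_square power3_eq_cube mult.assoc)
  have minus: "qpochhammer_inf (- inverse z) q = qpochhammer_inf (- inverse z) (q ^ 3)
      * qpochhammer_inf (- inverse z * q) (q ^ 3) * qpochhammer_inf (- inverse z * q\<^sup>2) (q ^ 3)"
    by (rule qpochhammer_inf_dissect_3[OF nomeD(2)[OF q]])
  have nonzero: "q powi (- 1) * z \<noteq> 0" "q powi (- 2) * z \<noteq> 0"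
    using nomeD(1)[OF q] z by simp_all
  have arguments: "- (q powi (- 1) * z) * q ^ 3 = - z * q\<^sup>2" "- (q powi (- 2) * z) * q ^ 3 = - z * q"
    "- inverse (q powi (- 1) * z) = - inverse z * q" "- inverse (q powi (- 2) * z) = - inverse z * q\<^sup>2"
    using nomeD(1)[OF q] z by (simp_all add: power_int_minus field_simps power2_eq_square power3_eq_cube)
  have "jtheta (q ^ 3) z * jtheta (q ^ 3) (q powi (- 1) * z) * jtheta (q ^ 3) (q powi (- 2) * z)
      = euler_prod (q ^ 3) ^ 3 * qpochhammer_inf (- z * q) q * qpochhammer_inf (- inverse z) q"
    unfolding triple_product[OF z] triple_product[OF nonzero(1)] triple_product[OF nonzero(2)]
      arguments plus minus by algebra
  then show "jtheta (q ^ 3) z * jtheta (q ^ 3) (q powi (- 1) * z) * jtheta (q ^ 3) (q powi (- 2) * z)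
      = cubic_c q * jtheta q (z ^ 1)"
    using jacobi_triple_product[OF q z] euler_prod_nonzero[OF q] by (simp add: cubic_c_def)
qed simp_all

text \<open>The rotation of order three about \<open>(- 1/3, - 1/3)\<close>, the centre of the form \<open>hex_norm b c + b + c\<close>.\<close>

definition coset_rotation :: "int \<times> int \<Rightarrow> int \<times> int" where
  "coset_rotation = (\<lambda>(b, c). (c, - 1 - b - c))"

lemma hex_theta_coset_split:
  assumes q: "nome q" and moves: "\<And>x. p x \<Longrightarrow> \<not> p (coset_rotation x)"
  shows "hex_theta q q q = 3 * infsum (hex_term q q q) {x. p x} + infsum (hex_term q q q)
    {x. \<not> p x \<and> \<not> p (coset_rotation x) \<and> \<not> p (coset_rotation (coset_rotation x))}"
  unfolding hex_theta_def
proof (rule infsum_split_rotation)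
  show "hex_term q q q summable_on UNIV"
    using has_sum_hex_theta[OF q] nomeD(1)[OF q] by (blast intro: has_sum_imp_summable)
  show "hex_term q q q (coset_rotation x) = hex_term q q q x" for x
    using hex_term_powi[OF q, of 1 1 1] by (cases x) (simp add: coset_rotation_def hex_norm_def algebra_simps)
qed (use moves in \<open>auto simp: coset_rotation_def\<close>)

lemma hex_theta_coset:
  assumes q: "nome q"
  shows "hex_theta q q q = 3 * cubic_c q"
proof -
  let ?p = "\<lambda>x. 3 dvd fst x - snd x"
  have "hex_theta q q q = 3 * infsum (hex_term q q q) {x. ?p x} + infsum (hex_term q q q)
      {x. \<not> ?p x \<and> \<not> ?p (coset_rotation x) \<and> \<not> ?p (coset_rotation (coset_rotation x))}"
    by (rule hex_theta_coset_split[OF q]) (auto simp: coset_rotation_def, presburger)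
  also have "{x. \<not> ?p x \<and> \<not> ?p (coset_rotation x) \<and> \<not> ?p (coset_rotation (coset_rotation x))} = {}"
    by (auto simp: coset_rotation_def) presburger
  also have "infsum (hex_term q q q) {x. ?p x} = hex_theta (q ^ 3) (q powi (- 1)) (q powi (- 2))"
    unfolding hex_theta_def using hex_term_powi[OF q, of 1 1 1] hex_term_powi[OF q, of 3 "- 1" "- 2"]
    by (intro infsum_reindex_bij_witness[of _ "\<lambda>(b, c). (b - c, - 2 * b - c)"
          "\<lambda>(b, c). ((b - c) div 3, (b - c) div 3 - b)"])
       (auto simp: hex_norm_def algebra_simps)
  finally show ?thesis
    unfolding hex_theta_third_coset[OF q] by simp
qed

section \<open>Theta values as products\<close>

definition phi :: "complex \<Rightarrow> complex" where
  "phi q = jtheta (q\<^sup>2) (q powi (- 1))"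

lemma has_sum_phi:
  assumes "nome q"
  shows "((\<lambda>m. q powi (m * m)) has_sum phi q) UNIV"
  unfolding phi_def using two_tri
  by (intro has_sum_powi_tri_linear[OF assms]) (auto simp: algebra_simps)

lemma phi_eq:
  assumes q: "nome q"
  shows "phi q = (euler_prod (- q))\<^sup>2 / euler_prod (q\<^sup>2)"
proof -
  have "phi q = euler_prod (q\<^sup>2) * (qpochhammer_inf (- q) (q\<^sup>2))\<^sup>2"
    using jacobi_triple_product[OF nome_power[OF q, of 2], of "q powi (- 1)"] nomeD(1)[OF q]
    by (simp add: phi_def power2_eq_square field_simps)
  then show ?thesis
    using euler_prod_power_nonzero[OF q, of 2]
    by (simp add: qpochhammer_inf_uminus_square[OF q] power_divide power2_eq_square[of "euler_prod _"])
qed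

corollary phi_eq_eta_quotient:
  assumes q: "nome q"
  shows "phi q = euler_prod (q\<^sup>2) ^ 5 / ((euler_prod q)\<^sup>2 * (euler_prod (q ^ 4))\<^sup>2)"
  using euler_prod_mult_euler_prod_uminus[OF q] euler_prod_nonzero[OF q]
    euler_prod_power_nonzero[OF q, of 2] euler_prod_power_nonzero[OF q, of 4]
  unfolding phi_eq[OF q] by (simp add: divide_simps) algebra

lemma jtheta_at_1:
  assumes q: "nome q"
  shows "jtheta q 1 = 2 * (euler_prod (q\<^sup>2))\<^sup>2 / euler_prod q"
proof -
  have "jtheta q 1 = euler_prod q * qpochhammer_inf (- q) q * qpochhammer_inf (- 1) q"
    using jacobi_triple_product[OF q, of 1] by simp
  also have "qpochhammer_inf (- 1) q = 2 * qpochhammer_inf (- q) q"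
    using qpochhammer_inf_unfold[OF nomeD(2)[OF q], of "- 1"] by simp
  finally show ?thesis
    using euler_prod_nonzero[OF q] by (simp add: qpochhammer_inf_uminus_self[OF q] power2_eq_square)
qed

lemma jtheta_cube_root:
  assumes q: "nome q" and \<omega>: "\<omega>\<^sup>2 + \<omega> + 1 = 0"
  shows "jtheta q \<omega> = - \<omega> * ((euler_prod q)\<^sup>2 * euler_prod (q ^ 6) / (euler_prod (q\<^sup>2) * euler_prod (q ^ 3)))"
proof -
  have \<omega>3: "\<omega> ^ 3 = 1" using \<omega> by algebra
  then have "\<omega> \<noteq> 0" by auto
  have "inverse \<omega> = \<omega>\<^sup>2"
    using \<omega>3 \<open>\<omega> \<noteq> 0\<close> by (simp add: field_simps power2_eq_square power3_eq_cube)
  then have "jtheta q \<omega> = euler_prod q * qpochhammer_inf (- \<omega> * q) q * qpochhammer_inf (- (\<omega>\<^sup>2)) q"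
    using jacobi_triple_product[OF q \<open>\<omega> \<noteq> 0\<close>] by simp
  also have "qpochhammer_inf (- (\<omega>\<^sup>2)) q = (1 + \<omega>\<^sup>2) * qpochhammer_inf (- (\<omega>\<^sup>2) * q) q"
    using qpochhammer_inf_unfold[OF nomeD(2)[OF q], of "- (\<omega>\<^sup>2)"] by simp
  also have "1 + \<omega>\<^sup>2 = - \<omega>" using \<omega> by algebra
  finally have "jtheta q \<omega> * qpochhammer_inf (- q) q
      = - \<omega> * euler_prod q
        * (qpochhammer_inf (- q) q * qpochhammer_inf (\<omega> * - q) q * qpochhammer_inf (\<omega>\<^sup>2 * - q) q)"
    by simp
  also have "\<dots> = - \<omega> * euler_prod q * (euler_prod (q ^ 6) / euler_prod (q ^ 3))"
    using qpochhammer_inf_mult_cube_roots[OF nomeD(2)[OF q] \<omega>, of "- q"]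
      qpochhammer_inf_uminus_self[OF nome_power[OF q, of 3]] by (simp flip: power_mult)
  finally show ?thesis
    using euler_prod_nonzero[OF q] euler_prod_power_nonzero[OF q, of 2]
      euler_prod_power_nonzero[OF q, of 3]
    by (simp add: qpochhammer_inf_uminus_self[OF q] field_simps power2_eq_square)
qed

lemma jtheta_power_3_inverse:
  assumes q: "nome q"
  shows "jtheta (q ^ 3) (q powi (- 1))
    = euler_prod (q\<^sup>2) * (euler_prod (q ^ 3))\<^sup>2 / (euler_prod q * euler_prod (q ^ 6))"
proof -
  have "jtheta (q ^ 3) (q powi (- 1))
      = euler_prod (q ^ 3) * qpochhammer_inf (- (q\<^sup>2)) (q ^ 3) * qpochhammer_inf (- q) (q ^ 3)"
    using jacobi_triple_product[OF nome_power[OF q, of 3], of "q powi (- 1)"] nomeD(1)[OF q]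
    by (simp add: power2_eq_square power3_eq_cube field_simps)
  moreover have "qpochhammer_inf (- q) q = qpochhammer_inf (- q) (q ^ 3) * qpochhammer_inf (- (q\<^sup>2)) (q ^ 3)
      * qpochhammer_inf (- (q ^ 3)) (q ^ 3)"
    using qpochhammer_inf_dissect_3[OF nomeD(2)[OF q], of "- q"]
    by (simp add: power2_eq_square power3_eq_cube mult.assoc)
  moreover have "qpochhammer_inf (- (q ^ 3)) (q ^ 3) = euler_prod (q ^ 6) / euler_prod (q ^ 3)"
    using qpochhammer_inf_uminus_self[OF nome_power[OF q, of 3]] by (simp flip: power_mult)
  ultimately show ?thesis
    using euler_prod_nonzero[OF q] euler_prod_power_nonzero[OF q, of 3]
      euler_prod_power_nonzero[OF q, of 6]
    by (simp add: qpochhammer_inf_uminus_self[OF q] field_simps) algebra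
qed

lemma jtheta_power_6_inverse:
  assumes q: "nome q"
  shows "jtheta (q ^ 6) (q powi (- 1))
    = (euler_prod (q ^ 6))\<^sup>2 * euler_prod (- q) / (euler_prod (q\<^sup>2) * euler_prod (- (q ^ 3)))"
proof -
  have "jtheta (q ^ 6) (q powi (- 1))
      = euler_prod (q ^ 6) * qpochhammer_inf (- (q ^ 5)) (q ^ 6) * qpochhammer_inf (- q) (q ^ 6)"
    using jacobi_triple_product[OF nome_power[OF q, of 6], of "q powi (- 1)"] nomeD(1)[OF q]
    by (simp add: eval_nat_numeral field_simps)
  moreover have "qpochhammer_inf (- q) (q\<^sup>2) = qpochhammer_inf (- q) (q ^ 6)
      * qpochhammer_inf (- (q ^ 3)) (q ^ 6) * qpochhammer_inf (- (q ^ 5)) (q ^ 6)"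
    using qpochhammer_inf_dissect_3[OF nomeD(2)[OF nome_power[OF q, of 2]], of "- q"]
    by (simp add: eval_nat_numeral mult.assoc)
  moreover have "qpochhammer_inf (- (q ^ 3)) (q ^ 6) = euler_prod (- (q ^ 3)) / euler_prod (q ^ 6)"
    using qpochhammer_inf_uminus_square[OF nome_power[OF q, of 3]] by (simp flip: power_mult)
  ultimately show ?thesis
    using euler_prod_nonzero[OF nome_uminus[OF nome_power[OF q, of 3]]]
      euler_prod_power_nonzero[OF q, of 2] euler_prod_power_nonzero[OF q, of 6]
    by (simp add: qpochhammer_inf_uminus_square[OF q] field_simps) algebra
qed

section \<open>Parity dissections\<close>

lemma jtheta_mult_jtheta_at_1:
  assumes p: "nome p" and q: "nome q"
  shows "jtheta p z * jtheta q 1 = 2 * (\<Sum>\<^sub>\<infinity>(n, k). p powi tri n * z powi n * q powi tri (n + 2 * k))"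
proof -
  let ?f = "\<lambda>(n, m). (p powi tri n * z powi n) * (q powi tri m * 1 powi m)"
  have series: "(?f has_sum jtheta p z * jtheta q 1) UNIV"
    using has_sum_times[OF has_sum_jtheta[OF p, of z] has_sum_jtheta[OF q, of 1]] by simp
  have "infsum ?f UNIV = 2 * infsum ?f {x. even (snd x - fst x)}"
    by (rule infsum_split_involution[OF has_sum_imp_summable[OF series], of "\<lambda>(n, m). (n, - 1 - m)"])
       (auto simp: tri_reflect)
  also have "infsum ?f {x. even (snd x - fst x)}
      = (\<Sum>\<^sub>\<infinity>(n, k). p powi tri n * z powi n * q powi tri (n + 2 * k))"
    by (rule infsum_reindex_bij_witness[of _ "\<lambda>(n, k). (n, n + 2 * k)" "\<lambda>(n, m). (n, (m - n) div 2)"]) auto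
  finally show ?thesis using infsumI[OF series] by simp
qed

lemma hex_theta_square_nome:
  assumes q: "nome q"
  shows "2 * hex_theta (q\<^sup>2) q q = jtheta (q ^ 3) (q powi (- 1)) * jtheta q 1"
proof -
  have exponent: "3 * tri n + - n + tri (n + 2 * k) = int 2 * hex_norm n k + 1 * n + 1 * k" for n k
    using two_tri[of n] two_tri[of "n + 2 * k"] by (simp add: hex_norm_def algebra_simps)
  have "(q ^ 3) powi tri n * (q powi (- 1)) powi n * q powi tri (n + 2 * k)
      = q powi (3 * tri n + - n + tri (n + 2 * k))" for n k
    using nomeD(1)[OF q]
    by (simp add: power_int_power power_int_diff power_int_add power_int_inverse field_simps)
  also have "\<dots> n k = hex_term (q\<^sup>2) q q (n, k)" for n k
    unfolding exponent hex_term_powi[OF q, symmetric] by simp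
  finally show ?thesis
    using jtheta_mult_jtheta_at_1[OF nome_power[OF q, of 3] q, of "q powi (- 1)"]
    by (simp add: hex_theta_def case_prod_unfold)
qed

definition cubic_d :: "complex \<Rightarrow> complex" where
  "cubic_d q = q * (euler_prod (q\<^sup>2))\<^sup>2 * euler_prod (q ^ 12) ^ 3
    / (euler_prod (q ^ 4) * (euler_prod (q ^ 6))\<^sup>2)"

lemma cubic_d_uminus: "cubic_d (- q) = - cubic_d q"
  by (simp add: cubic_d_def)

lemma hex_theta_coset_dissection:
  assumes q: "nome q"
  shows "hex_theta q q q = 3 * hex_theta (q ^ 4) (q\<^sup>2) (q\<^sup>2) + q * hex_theta (q ^ 4) (q ^ 4) (q ^ 4)"
proof -
  let ?p = "\<lambda>x :: int \<times> int. even (fst x) \<and> even (snd x)"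
  have "hex_theta q q q = 3 * infsum (hex_term q q q) {x. ?p x} + infsum (hex_term q q q)
      {x. \<not> ?p x \<and> \<not> ?p (coset_rotation x) \<and> \<not> ?p (coset_rotation (coset_rotation x))}"
    by (rule hex_theta_coset_split[OF q]) (auto simp: coset_rotation_def)
  also have "{x. \<not> ?p x \<and> \<not> ?p (coset_rotation x) \<and> \<not> ?p (coset_rotation (coset_rotation x))}
      = {x. odd (fst x) \<and> odd (snd x)}"
    by (auto simp: coset_rotation_def)
  also have "infsum (hex_term q q q) {x. ?p x} = hex_theta (q ^ 4) (q\<^sup>2) (q\<^sup>2)"
    unfolding hex_theta_def using hex_term_powi[OF q, of 1 1 1] hex_term_powi[OF q, of 4 2 2]
    by (intro infsum_reindex_bij_witness[of _ "\<lambda>(i, j). (2 * i, 2 * j)" "\<lambda>(b, c). (b div 2, c div 2)"])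
       (auto elim!: evenE simp: hex_norm_def algebra_simps)
  also have "infsum (hex_term q q q) {x. odd (fst x) \<and> odd (snd x)}
      = (\<Sum>\<^sub>\<infinity>p. q * hex_term (q ^ 4) (q ^ 4) (q ^ 4) p)"
    using hex_term_powi[OF q, of 1 1 1] hex_term_powi[OF q, of 4 4 4] nomeD(1)[OF q]
    by (intro infsum_reindex_bij_witness[of _ "\<lambda>(i, j). (- 2 * i - 1, - 2 * j - 1)"
          "\<lambda>(b, c). ((- 1 - b) div 2, (- 1 - c) div 2)"])
       (auto elim!: oddE simp: hex_norm_def algebra_simps simp flip: power_int_add_1')
  finally show ?thesis by (simp add: hex_theta_def infsum_cmult_right')
qed

lemma cubic_c_power_4:
  assumes q: "nome q"
  shows "q * cubic_c (q ^ 4) = (euler_prod (q ^ 6) / euler_prod (q\<^sup>2))\<^sup>2 * cubic_d q"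
  using euler_prod_power_nonzero[OF q, of 2] euler_prod_power_nonzero[OF q, of 6]
  by (simp add: cubic_c_def cubic_d_def divide_simps flip: power_mult)

lemma cubic_c_dissection:
  assumes q: "nome q"
  shows "cubic_c q = (euler_prod (q ^ 6) / euler_prod (q\<^sup>2))\<^sup>2 * (cubic_b (q ^ 4) + cubic_d q)"
proof -
  let ?E = "\<lambda>n :: nat. euler_prod (q ^ n)"
  have nonzero: "?E 2 \<noteq> 0" "?E 4 \<noteq> 0" "?E 6 \<noteq> 0" "?E 12 \<noteq> 0"
    by (simp_all add: euler_prod_nonzero nome_power q)
  have "2 * hex_theta (q ^ 4) (q\<^sup>2) (q\<^sup>2) = (?E 4 * (?E 6)\<^sup>2 / (?E 2 * ?E 12)) * (2 * (?E 4)\<^sup>2 / ?E 2)"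
    using hex_theta_square_nome[OF nome_power[OF q, of 2]] jtheta_power_3_inverse[OF nome_power[OF q, of 2]]
      jtheta_at_1[OF nome_power[OF q, of 2]]
    by (simp flip: power_mult)
  then have "hex_theta (q ^ 4) (q\<^sup>2) (q\<^sup>2) = (?E 6 / ?E 2)\<^sup>2 * cubic_b (q ^ 4)"
    using nonzero by (simp add: cubic_b_def divide_simps flip: power_mult) algebra
  moreover have "3 * cubic_c q = 3 * (hex_theta (q ^ 4) (q\<^sup>2) (q\<^sup>2) + q * cubic_c (q ^ 4))"
    using hex_theta_coset_dissection[OF q] hex_theta_coset[OF q] hex_theta_coset[OF nome_power[OF q, of 4]]
    by (simp add: algebra_simps)
  ultimately show ?thesis
    using cubic_c_power_4[OF q] by algebra
qed

corollary cubic_c_uminus_dissection: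
  assumes "nome q"
  shows "cubic_c (- q) = (euler_prod (q ^ 6) / euler_prod (q\<^sup>2))\<^sup>2 * (cubic_b (q ^ 4) - cubic_d q)"
  using cubic_c_dissection[OF nome_uminus[OF assms]] by (simp add: cubic_d_uminus)

lemma infsum_cube_roots_odd_even:
  assumes q: "nome q" and \<omega>: "\<omega> ^ 3 = 1"
  shows "2 * infsum (hex_term q \<omega> (\<omega>\<^sup>2)) {x. odd (fst x) \<and> even (snd x)}
    = q * \<omega> * (jtheta (q\<^sup>2) (\<omega>\<^sup>2) * jtheta (q ^ 6) 1)"
proof -
  let ?t = "\<lambda>(n, k). (q\<^sup>2) powi tri n * (\<omega>\<^sup>2) powi n * (q ^ 6) powi tri (n + 2 * k)"
  have nonzero: "\<omega> \<noteq> 0" using \<omega> by auto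
  have "hex_term q \<omega> (\<omega>\<^sup>2) (2 * n + 4 * k + 1, - 2 * k) = q * \<omega> * ?t (n, k)" for n k
  proof -
    have "hex_norm (2 * n + 4 * k + 1) (- 2 * k) = 1 + (2 * tri n + 6 * tri (n + 2 * k))"
      using two_tri[of n] two_tri[of "n + 2 * k"] by (simp add: hex_norm_def algebra_simps)
    then have "q powi hex_norm (2 * n + 4 * k + 1) (- 2 * k)
        = q * ((q\<^sup>2) powi tri n * (q ^ 6) powi tri (n + 2 * k))"
      using nomeD(1)[OF q] by (simp only:) (simp add: power_int_power power_int_add)
    moreover have "\<omega> powi (2 * n + 4 * k + 1) * (\<omega>\<^sup>2) powi (- 2 * k) = \<omega> * (\<omega>\<^sup>2) powi n"
      using nonzero by (simp add: power_int_power power_int_add power_int_minus field_simps)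
    ultimately show ?thesis
      unfolding hex_term_def prod.case mult.assoc[of _ "\<omega> powi _"] by (simp only: mult_ac)
  qed
  then have "(\<Sum>\<^sub>\<infinity>x. q * \<omega> * ?t x) = infsum (hex_term q \<omega> (\<omega>\<^sup>2)) {x. odd (fst x) \<and> even (snd x)}"
    by (intro infsum_reindex_bij_witness[of _ "\<lambda>(b, c). ((b - 1) div 2 + c, - (c div 2))"
          "\<lambda>(n, k). (2 * n + 4 * k + 1, - 2 * k)"])
       (auto elim!: oddE evenE, presburger)
  then have "infsum (hex_term q \<omega> (\<omega>\<^sup>2)) {x. odd (fst x) \<and> even (snd x)} = q * \<omega> * infsum ?t UNIV"
    by (simp only: infsum_cmult_right'[of "q * \<omega>" ?t])
  then show ?thesis
    unfolding jtheta_mult_jtheta_at_1[OF nome_power[OF q, of 2, simplified]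
        nome_power[OF q, of 6, simplified]]
    by (simp only: mult_ac)
qed

lemma hex_theta_cube_roots_dissection:
  assumes q: "nome q" and \<omega>: "\<omega> ^ 3 = 1"
  shows "2 * hex_theta q \<omega> (\<omega>\<^sup>2) = 2 * hex_theta (q ^ 4) (\<omega>\<^sup>2) ((\<omega>\<^sup>2)\<^sup>2)
    + 3 * (q * \<omega> * (jtheta (q\<^sup>2) (\<omega>\<^sup>2) * jtheta (q ^ 6) 1))"
proof -
  let ?f = "hex_term q \<omega> (\<omega>\<^sup>2)"
  let ?p = "\<lambda>x :: int \<times> int. odd (fst x) \<and> even (snd x)"
  define \<rho> :: "int \<times> int \<Rightarrow> int \<times> int" where "\<rho> = (\<lambda>(b, c). (c, - b - c))"
  have nonzero: "\<omega> \<noteq> 0" using \<omega> by auto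
  then have "?f summable_on UNIV"
    using has_sum_hex_theta[OF q, of \<omega> "\<omega>\<^sup>2"] by (auto dest: has_sum_imp_summable)
  moreover have "?f (\<rho> x) = ?f x" for x
  proof -
    have "\<omega> powi c * (\<omega>\<^sup>2) powi (- b - c) * (\<omega> ^ 3) powi (b + c) = \<omega> powi b * (\<omega>\<^sup>2) powi c" for b c
      using nonzero by (simp add: power_int_power algebra_simps flip: power_int_add)
    then show ?thesis
      by (cases x) (simp add: \<rho>_def \<omega> hex_term_def hex_norm_def algebra_simps)
  qed
  ultimately have "infsum ?f UNIV
      = 3 * infsum ?f {x. ?p x} + infsum ?f {x. \<not> ?p x \<and> \<not> ?p (\<rho> x) \<and> \<not> ?p (\<rho> (\<rho> x))}"
    by (rule infsum_split_rotation) (auto simp: \<rho>_def)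
  also have "{x. \<not> ?p x \<and> \<not> ?p (\<rho> x) \<and> \<not> ?p (\<rho> (\<rho> x))} = {x. even (fst x) \<and> even (snd x)}"
    by (auto simp: \<rho>_def)
  also have "infsum ?f \<dots> = hex_theta (q ^ 4) (\<omega>\<^sup>2) ((\<omega>\<^sup>2)\<^sup>2)"
    unfolding hex_theta_def
    by (rule infsum_reindex_bij_witness[of _ "\<lambda>(i, j). (2 * i, 2 * j)" "\<lambda>(b, c). (b div 2, c div 2)"])
       (auto elim!: evenE simp: hex_term_def hex_norm_def power_int_power algebra_simps simp flip: power_mult)
  finally show ?thesis
    unfolding hex_theta_def[of q] infsum_cube_roots_odd_even[OF q \<omega>, symmetric] by algebra
qed

lemma cubic_b_dissection:
  assumes q: "nome q"
  shows "cubic_b q = cubic_b (q ^ 4) - 3 * cubic_d q"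
proof -
  let ?E = "\<lambda>n :: nat. euler_prod (q ^ n)"
  define \<omega> where "\<omega> = Complex (- 1 / 2) (sqrt 3 / 2)"
  have \<omega>: "\<omega>\<^sup>2 + \<omega> + 1 = 0"
    by (simp add: \<omega>_def complex_eq_iff power2_eq_square field_simps)
  then have \<omega>2: "(\<omega>\<^sup>2)\<^sup>2 + \<omega>\<^sup>2 + 1 = 0" and "\<omega> ^ 3 = 1"
    by algebra+
  have nonzero: "?E 2 \<noteq> 0" "?E 4 \<noteq> 0" "?E 6 \<noteq> 0" "?E 12 \<noteq> 0"
    by (simp_all add: euler_prod_nonzero nome_power q)
  have "jtheta (q\<^sup>2) (\<omega>\<^sup>2) = - (\<omega>\<^sup>2) * ((?E 2)\<^sup>2 * ?E 12 / (?E 4 * ?E 6))"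
    using jtheta_cube_root[OF nome_power[OF q, of 2] \<omega>2] by (simp flip: power_mult)
  moreover have "jtheta (q ^ 6) 1 = 2 * (?E 12)\<^sup>2 / ?E 6"
    using jtheta_at_1[OF nome_power[OF q, of 6]] by (simp flip: power_mult)
  ultimately have "q * \<omega> * (jtheta (q\<^sup>2) (\<omega>\<^sup>2) * jtheta (q ^ 6) 1) = - (\<omega> ^ 3) * (2 * cubic_d q)"
    using nonzero by (simp add: cubic_d_def divide_simps) algebra
  then have "2 * cubic_b q = 2 * (cubic_b (q ^ 4) - 3 * cubic_d q)"
    using hex_theta_cube_roots_dissection[OF q \<open>\<omega> ^ 3 = 1\<close>] hex_theta_cube_roots[OF q \<omega>]
      hex_theta_cube_roots[OF nome_power[OF q, of 4] \<omega>2] \<open>\<omega> ^ 3 = 1\<close>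
    by (simp add: algebra_simps)
  then show ?thesis by algebra
qed

corollary cubic_b_uminus_dissection:
  assumes "nome q"
  shows "cubic_b (- q) = cubic_b (q ^ 4) + 3 * cubic_d q"
  using cubic_b_dissection[OF nome_uminus[OF assms]] by (simp add: cubic_d_uminus)

lemma hex_theta_1_1:
  assumes q: "nome q"
  shows "hex_theta q 1 1 = phi q * phi (q ^ 3) + q * (jtheta (q\<^sup>2) 1 * jtheta (q ^ 6) 1)"
proof -
  let ?f = "hex_term q 1 1"
  have "((\<lambda>n. q powi (3 * (n * n))) has_sum phi (q ^ 3)) UNIV"
    using has_sum_phi[OF nome_power[OF q, of 3]] by (simp add: power_int_power)
  note phi_phi = has_sum_powi_times[OF nomeD(1)[OF q] has_sum_phi[OF q] this]
  have "m * m + m = int 2 * tri m + 0 * m" "3 * (m * m + m) = int 6 * tri m + 0 * m" for m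
    using two_tri[of m] by (simp_all add: algebra_simps)
  then have "((\<lambda>m. q powi (m * m + m)) has_sum jtheta (q\<^sup>2) (q powi 0)) UNIV"
    "((\<lambda>m. q powi (3 * (m * m + m))) has_sum jtheta (q ^ 6) (q powi 0)) UNIV"
    by (intro has_sum_powi_tri_linear[OF q]; simp)+
  note jtheta_jtheta = has_sum_powi_times[OF nomeD(1)[OF q] this]
  have "infsum ?f {x. even (snd x)} = (\<Sum>\<^sub>\<infinity>(m, n). q powi (m * m + 3 * (n * n)))"
    by (rule infsum_reindex_bij_witness[of _ "\<lambda>(m, n). (m - n, 2 * n)" "\<lambda>(b, c). (b + c div 2, c div 2)"])
       (auto elim!: evenE simp: hex_term_def hex_norm_def algebra_simps)
  moreover have "infsum ?f {x. odd (snd x)} = (\<Sum>\<^sub>\<infinity>(m, n). q powi (m * m + m + 3 * (n * n + n) + 1))"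
    by (rule infsum_reindex_bij_witness[of _ "\<lambda>(m, n). (m - n, 2 * n + 1)" "\<lambda>(b, c). (b + c div 2, c div 2)"])
       (auto elim!: oddE simp: hex_term_def hex_norm_def algebra_simps)
  moreover have "\<dots> = q * (jtheta (q\<^sup>2) 1 * jtheta (q ^ 6) 1)"
    using infsumI[OF has_sum_cmult_right[OF jtheta_jtheta, of q]] nomeD(1)[OF q]
    by (simp add: case_prod_unfold power_int_add_1')
  ultimately show ?thesis
    using infsum_split[OF has_sum_imp_summable[OF has_sum_hex_theta[OF q, of 1 1]], of "\<lambda>x. even (snd x)"]
      infsumI[OF phi_phi]
    by (simp add: hex_theta_def)
qed

section \<open>Six colours\<close>

lemma hex_theta_diagonal_shift:
  assumes q: "nome q"
  shows "q powi ((3 * s + j) * (3 * s + j)) * (hex_theta q (q powi (3 * s + j)) (q powi (3 * s + j)))\<^sup>2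
    = q powi (j * j) * (hex_theta q (q powi j) (q powi j))\<^sup>2 * q powi (3 * s * s + 2 * j * s)"
proof -
  define e where "e = 3 * s * s + 2 * j * s"
  have nonzero: "q \<noteq> 0" using nomeD(1)[OF q] .
  have "(q powi j * q powi j) powi s = q powi (2 * j * s)"
    unfolding power_int_add[OF disjI1[OF nonzero], symmetric] mult_2[symmetric] power_int_mult ..
  then have shift: "hex_theta q (q powi j) (q powi j)
      = q powi e * hex_theta q (q powi (3 * s + j)) (q powi (3 * s + j))"
    using hex_theta_shift[OF q, of "q powi j" "q powi j" s] nonzero
    by (simp add: e_def power_int_add add.commute)
  have "(3 * s + j) * (3 * s + j) = j * j + e + e + e"
    by (simp add: e_def algebra_simps)
  then have "q powi ((3 * s + j) * (3 * s + j)) = q powi (j * j) * q powi e * q powi e * q powi e"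
    using nonzero by (simp only: power_int_add simp_thms)
  then show ?thesis
    unfolding shift e_def[symmetric] by algebra
qed

lemma CPhi_6_hex_theta_sum:
  assumes q: "nome q"
  shows "((\<lambda>j. q powi (j * j) * (hex_theta q (q powi j) (q powi j))\<^sup>2) has_sum
    euler_prod q ^ 6 * CPhi 6 q) UNIV"
proof -
  define g where "g j = hex_theta q (q powi j) (q powi j)" for j
  let ?h = "\<lambda>j. q powi tri j * g (- j)"
  have square: "((\<lambda>(i, j). ?h i * ?h j * z powi (i + j)) has_sum jtheta q z ^ 6) UNIV" if "norm z = 1" for z
  proof -
    have "z \<noteq> 0" using that by auto
    then have "((\<lambda>j. ?h j * z powi j) has_sum jtheta q z ^ 3) UNIV"
      using has_sum_three_jtheta_laurent[OF q, of z 1 1] by (simp add: g_def power3_eq_cube)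
    from has_sum_times[OF this this] show ?thesis
      using \<open>z \<noteq> 0\<close> by (simp add: case_prod_unfold power_int_add mult_ac flip: power_add)
  qed
  have "(\<lambda>(i, j). ?h i * ?h j) summable_on {p \<in> UNIV. fst p + snd p = 0}"
    using has_sum_imp_summable[OF square[of 1]] by (auto elim: summable_on_subset_banach)
  moreover have constant_term: "euler_prod q ^ 6 * CPhi 6 q
      = infsum (\<lambda>(i, j). ?h i * ?h j) {p \<in> UNIV. fst p + snd p = 0}"
    using square by (intro CPhi_eq_constant_term[OF q]) (simp add: case_prod_unfold)
  ultimately have "((\<lambda>(i, j). ?h i * ?h j) has_sum euler_prod q ^ 6 * CPhi 6 q) {p \<in> UNIV. fst p + snd p = 0}"
    unfolding constant_term by (intro has_sum_infsum)
  moreover have "?h j * ?h (- j) = q powi (j * j) * (g j)\<^sup>2" for j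
  proof -
    have "tri j + tri (- j) = j * j"
      using two_tri[of j] two_tri[of "- j"] by (simp add: algebra_simps)
    moreover have "g (- j) = g j"
      using hex_theta_inverse[of q "q powi j" "q powi j"] by (simp add: g_def power_int_minus)
    ultimately show ?thesis
      using nomeD(1)[OF q] power_int_add[of q "tri j" "tri (- j)"] by (simp add: power2_eq_square)
  qed
  ultimately have "((\<lambda>j. q powi (j * j) * (g j)\<^sup>2) has_sum euler_prod q ^ 6 * CPhi 6 q) UNIV"
    by (elim has_sum_reindex_bij_witness[of _ "\<lambda>j. (j, - j)" fst, THEN iffD1, rotated -1])
       (auto simp: add_eq_0_iff)
  then show ?thesis by (simp only: g_def)
qed

lemma CPhi_6_theta:
  assumes q: "nome q"
  shows "euler_prod q ^ 6 * CPhi 6 q = phi (q ^ 3) * (hex_theta q 1 1)\<^sup>2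
    + 2 * q * (hex_theta q q q)\<^sup>2 * jtheta (q ^ 6) (q powi (- 1))"
proof -
  define f where "f j = q powi (j * j) * (hex_theta q (q powi j) (q powi j))\<^sup>2" for j
  let ?J = "jtheta (q ^ 6) (q powi (- 1))"
  have shift: "f (3 * s + j) = f j * q powi (3 * s * s + 2 * j * s)" for s j
    using hex_theta_diagonal_shift[OF q] by (simp only: f_def)
  have "3 * s * s + 2 * s = int 6 * tri s + - 1 * s" for s
    using two_tri[of s] by (simp add: algebra_simps)
  then have odd_series: "((\<lambda>s. q powi (3 * s * s + 2 * s)) has_sum ?J) UNIV"
    by (intro has_sum_powi_tri_linear[OF q]) simp_all
  then have reflected_series: "((\<lambda>s. q powi (3 * s * s - 2 * s)) has_sum ?J) UNIV"
    by (rule has_sum_reindex_bij_witness[of _ uminus uminus, THEN iffD1, rotated -1]) simp_all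
  have "((\<lambda>s. f (3 * s)) has_sum f 0 * phi (q ^ 3)) UNIV"
    using shift[of _ 0] has_sum_cmult_right[OF has_sum_phi[OF nome_power[OF q, of 3]], of "f 0"]
    by (simp add: power_int_power mult.assoc)
  moreover have "((\<lambda>s. f (3 * s + 1)) has_sum f 1 * ?J) UNIV"
    using shift[of _ 1] has_sum_cmult_right[OF odd_series, of "f 1"] by simp
  moreover have "((\<lambda>s. f (3 * s - 1)) has_sum f (- 1) * ?J) UNIV"
    using shift[of _ "- 1"] has_sum_cmult_right[OF reflected_series, of "f (- 1)"] by simp
  ultimately have "(f has_sum f 0 * phi (q ^ 3) + f 1 * ?J + f (- 1) * ?J) UNIV"
    by (rule has_sum_int_mod_3)
  then have "euler_prod q ^ 6 * CPhi 6 q = f 0 * phi (q ^ 3) + f 1 * ?J + f (- 1) * ?J"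
    by (rule has_sum_unique[OF CPhi_6_hex_theta_sum[OF q, folded f_def]])
  moreover have "f 0 = (hex_theta q 1 1)\<^sup>2" "f 1 = q * (hex_theta q q q)\<^sup>2"
    "f (- 1) = q * (hex_theta q q q)\<^sup>2"
    using hex_theta_inverse[of q q q] by (simp_all add: f_def)
  ultimately show ?thesis by (simp add: algebra_simps)
qed

section \<open>The cubic theta functions\<close>

lemma cubic_b_mult_cubic_b_uminus:
  assumes q: "nome q"
  shows "cubic_b q * cubic_b (- q) * cubic_b (q ^ 4) = cubic_b (q\<^sup>2) ^ 3"
  using arg_cong2[OF euler_prod_mult_euler_prod_uminus[OF q]
        euler_prod_mult_euler_prod_uminus[OF nome_power[OF q, of 3]], of "\<lambda>x y. x ^ 3 / y"]
  by (simp add: cubic_b_def power_mult_distrib power_divide flip: power_mult)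

lemma cubic_c_mult_cubic_c_uminus:
  assumes q: "nome q"
  shows "cubic_c q * cubic_c (- q) * cubic_c (q ^ 4) = cubic_c (q\<^sup>2) ^ 3"
  using arg_cong2[OF euler_prod_mult_euler_prod_uminus[OF q]
        euler_prod_mult_euler_prod_uminus[OF nome_power[OF q, of 3]], of "\<lambda>x y. y ^ 3 / x"]
  by (simp add: cubic_c_def power_mult_distrib power_divide flip: power_mult)

lemma cubic_b_mult_phi_phi:
  assumes q: "nome q"
  shows "cubic_b (q\<^sup>2) * (phi q * phi (q ^ 3)) = cubic_b (- q) * (cubic_b (q ^ 4) - cubic_d q)"
proof -
  let ?E = "\<lambda>n :: nat. euler_prod (q ^ n)"
  have nonzero: "?E 2 \<noteq> 0" "?E 6 \<noteq> 0" "euler_prod (- q) \<noteq> 0" "euler_prod (- (q ^ 3)) \<noteq> 0"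
    by (simp_all add: euler_prod_nonzero nome_power nome_uminus q)
  have "phi q * phi (q ^ 3) = cubic_b (- q) * cubic_c (- q) / (?E 2 * ?E 6)"
    using nonzero
    by (simp add: phi_eq nome_power q cubic_b_def cubic_c_def field_simps flip: power_mult) algebra
  then show ?thesis
    using nonzero unfolding cubic_c_uminus_dissection[OF q] by (simp add: cubic_b_def[of "q\<^sup>2"] divide_simps flip: power_mult) algebra
qed

lemma cubic_b_mult_hex_theta_1_1:
  assumes q: "nome q"
  shows "cubic_b (q\<^sup>2) * hex_theta q 1 1
    = cubic_b (- q) * (cubic_b (q ^ 4) - cubic_d q) + 4 * cubic_b (q ^ 4) * cubic_d q"
proof -
  let ?E = "\<lambda>n :: nat. euler_prod (q ^ n)"
  have nonzero: "?E 2 \<noteq> 0" "?E 4 \<noteq> 0" "?E 6 \<noteq> 0" "?E 12 \<noteq> 0"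
    by (simp_all add: euler_prod_nonzero nome_power q)
  have "jtheta (q\<^sup>2) 1 = 2 * (?E 4)\<^sup>2 / ?E 2" "jtheta (q ^ 6) 1 = 2 * (?E 12)\<^sup>2 / ?E 6"
    using jtheta_at_1[OF nome_power[OF q, of 2]] jtheta_at_1[OF nome_power[OF q, of 6]]
    by (simp_all flip: power_mult)
  then have "cubic_b (q\<^sup>2) * (q * (jtheta (q\<^sup>2) 1 * jtheta (q ^ 6) 1)) = 4 * cubic_b (q ^ 4) * cubic_d q"
    using nonzero by (simp add: cubic_b_def cubic_d_def divide_simps flip: power_mult) algebra
  then show ?thesis
    using cubic_b_mult_phi_phi[OF q] by (simp add: hex_theta_1_1[OF q] distrib_left)
qed

lemma phi_mult_jtheta_power_6_inverse:
  assumes q: "nome q"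
  shows "phi q * jtheta (q ^ 6) (q powi (- 1)) = (euler_prod (q ^ 6) / euler_prod (q\<^sup>2))\<^sup>2 * cubic_b (- q)"
  unfolding phi_eq[OF q] jtheta_power_6_inverse[OF q] cubic_b_def
  by (simp add: power_divide power2_eq_square[of "euler_prod _"] power3_eq_cube[of "euler_prod _"] mult_ac)

lemma cubic_parametrization_identity:
  fixes C D \<beta> s :: complex
  assumes "\<beta> \<noteq> 0" and \<beta>: "\<beta> ^ 3 = C * (C - 3 * D) * (C + 3 * D)" and s: "s * \<beta> ^ 3 = D * (C + D) * (C - D)"
    and F: "\<beta> * F = (C + 3 * D) * (C - D)" and A: "\<beta> * A = (C + 3 * D) * (C - D) + 4 * C * D"
  shows "F * A\<^sup>2 + 18 * s * (C + 3 * D) * (C + D)\<^sup>2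
    = 4 / 9 * (C - 3 * D) ^ 3 - 1 / 3 * \<beta> ^ 3 + 8 / 9 * C ^ 3
      + 36 * (s * (C + D) ^ 3) + 27 * (s * (D * (C + D) * (C - D))) + 72 * (s * D ^ 3)"
proof -
  have "\<beta> ^ 3 * (9 * (F * A\<^sup>2 + 18 * s * (C + 3 * D) * (C + D)\<^sup>2))
      = 9 * (\<beta> * F * (\<beta> * A)\<^sup>2) + 162 * (s * \<beta> ^ 3) * (C + 3 * D) * (C + D)\<^sup>2"
    by algebra
  also have "\<dots> = C * (C - 3 * D) * (C + 3 * D)
        * (4 * (C - 3 * D) ^ 3 - 3 * (C * (C - 3 * D) * (C + 3 * D)) + 8 * C ^ 3)
      + D * (C + D) * (C - D) * (324 * (C + D) ^ 3 + 243 * (D * (C + D) * (C - D)) + 648 * D ^ 3)"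
    unfolding F A s by algebra
  also have "\<dots> = \<beta> ^ 3 * (4 * (C - 3 * D) ^ 3 - 3 * \<beta> ^ 3 + 8 * C ^ 3
      + 324 * (s * (C + D) ^ 3) + 243 * (s * (D * (C + D) * (C - D))) + 648 * (s * D ^ 3))"
    unfolding \<beta>[symmetric] s[symmetric] by algebra
  finally show ?thesis
    using \<open>\<beta> \<noteq> 0\<close> by (simp add: mult_left_cancel) (simp add: field_simps)
qed

lemma cubic_c_eq_mult_cubic_b:
  assumes q: "nome q"
  shows "cubic_c q = (euler_prod (q ^ 3) / euler_prod q) ^ 4 * cubic_b q"
  using euler_prod_nonzero[OF q] euler_prod_power_nonzero[OF q, of 3]
  by (simp add: cubic_c_def cubic_b_def divide_simps) algebra

lemma cubic_c_square_nome_power_3: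
  assumes q: "nome q"
  shows "q * cubic_c (q\<^sup>2) ^ 3 = (euler_prod (q ^ 6) / euler_prod (q\<^sup>2)) ^ 6
    * (cubic_d q * (cubic_b (q ^ 4) + cubic_d q) * (cubic_b (q ^ 4) - cubic_d q))"
proof -
  define x where "x = euler_prod (q ^ 6) / euler_prod (q\<^sup>2)"
  show ?thesis
    using cubic_c_mult_cubic_c_uminus[OF q] cubic_c_dissection[OF q] cubic_c_uminus_dissection[OF q]
      cubic_c_power_4[OF q]
    unfolding x_def[symmetric] by algebra
qed

lemma cubic_b_square_nome_power_3:
  assumes q: "nome q"
  shows "q * (euler_prod (q ^ 6) / euler_prod (q\<^sup>2)) ^ 6 * cubic_b (q\<^sup>2) ^ 3
    = cubic_d q * (cubic_b (q ^ 4) + cubic_d q) * (cubic_b (q ^ 4) - cubic_d q)" (is "_ = ?rhs")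
proof -
  define x where "x = euler_prod (q ^ 6) / euler_prod (q\<^sup>2)"
  have "x \<noteq> 0"
    by (simp add: x_def euler_prod_power_nonzero q)
  have "cubic_c (q\<^sup>2) = x ^ 4 * cubic_b (q\<^sup>2)"
    using cubic_c_eq_mult_cubic_b[OF nome_power[OF q, of 2]] by (simp add: x_def flip: power_mult)
  then have "x ^ 6 * (q * x ^ 6 * cubic_b (q\<^sup>2) ^ 3) = x ^ 6 * ?rhs"
    using cubic_c_square_nome_power_3[OF q] unfolding x_def[symmetric] by algebra
  then show ?thesis
    using \<open>x \<noteq> 0\<close> by (simp add: x_def[symmetric])
qed

theorem CPhi_6_cubic:
  assumes q: "nome q"
  shows "phi q * (euler_prod q ^ 6 * CPhi 6 q)
    = 4 / 9 * cubic_b q ^ 3 - 1 / 3 * cubic_b (q\<^sup>2) ^ 3 + 8 / 9 * cubic_b (q ^ 4) ^ 3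
      + 36 * (q * cubic_c q ^ 3) + 27 * (q\<^sup>2 * cubic_c (q\<^sup>2) ^ 3) + 72 * (q ^ 4 * cubic_c (q ^ 4) ^ 3)"
proof -
  define C D x s where "C = cubic_b (q ^ 4)" and "D = cubic_d q"
    and "x = euler_prod (q ^ 6) / euler_prod (q\<^sup>2)" and "s = q * x ^ 6"
  note folds = C_def[symmetric] D_def[symmetric] x_def[symmetric]
  let ?\<beta> = "cubic_b (q\<^sup>2)"
  have b_values: "cubic_b q = C - 3 * D" "cubic_b (- q) = C + 3 * D"
    using cubic_b_dissection[OF q] cubic_b_uminus_dissection[OF q] unfolding folds .
  have c_values: "cubic_c q = x\<^sup>2 * (C + D)" "q * cubic_c (q ^ 4) = x\<^sup>2 * D"
    using cubic_c_dissection[OF q] cubic_c_power_4[OF q] unfolding folds .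
  have "phi q * (euler_prod q ^ 6 * CPhi 6 q) = phi q * phi (q ^ 3) * (hex_theta q 1 1)\<^sup>2
      + 18 * q * (cubic_c q)\<^sup>2 * (phi q * jtheta (q ^ 6) (q powi (- 1)))"
    unfolding CPhi_6_theta[OF q] hex_theta_coset[OF q] by algebra
  also have "\<dots> = phi q * phi (q ^ 3) * (hex_theta q 1 1)\<^sup>2 + 18 * s * (C + 3 * D) * (C + D)\<^sup>2"
    unfolding phi_mult_jtheta_power_6_inverse[OF q] b_values c_values s_def folds by algebra
  also have "\<dots> = 4 / 9 * (C - 3 * D) ^ 3 - 1 / 3 * ?\<beta> ^ 3 + 8 / 9 * C ^ 3
      + 36 * (s * (C + D) ^ 3) + 27 * (s * (D * (C + D) * (C - D))) + 72 * (s * D ^ 3)"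
  proof (rule cubic_parametrization_identity)
    show "?\<beta> \<noteq> 0"
      by (simp add: cubic_b_def euler_prod_nonzero nome_power q)
    show "?\<beta> ^ 3 = C * (C - 3 * D) * (C + 3 * D)"
      using cubic_b_mult_cubic_b_uminus[OF q] by (simp add: b_values folds mult_ac)
    show "s * ?\<beta> ^ 3 = D * (C + D) * (C - D)"
      using cubic_b_square_nome_power_3[OF q] unfolding s_def folds .
    show "?\<beta> * (phi q * phi (q ^ 3)) = (C + 3 * D) * (C - D)"
      using cubic_b_mult_phi_phi[OF q] unfolding b_values folds .
    show "?\<beta> * hex_theta q 1 1 = (C + 3 * D) * (C - D) + 4 * C * D"
      using cubic_b_mult_hex_theta_1_1[OF q] unfolding b_values folds .
  qed
  also have "s * (C + D) ^ 3 = q * cubic_c q ^ 3"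
    unfolding c_values s_def by algebra
  also have "s * (D * (C + D) * (C - D)) = q\<^sup>2 * cubic_c (q\<^sup>2) ^ 3"
    using cubic_c_square_nome_power_3[OF q] unfolding s_def folds by algebra
  also have "s * D ^ 3 = q ^ 4 * cubic_c (q ^ 4) ^ 3"
    using c_values(2) unfolding s_def by algebra
  finally show ?thesis
    unfolding b_values C_def .
qed

theorem theorem6p2:
  fixes q :: complex
  assumes "norm q < 1"
  shows "summable (\<lambda>n. of_nat (cphi 6 n) * q ^ n) \<and>
    CPhi 6 q =
        4 / 9 * (euler_prod q ^ 5 * euler_prod (q ^ 4) ^ 2
               / (euler_prod (q ^ 2) ^ 5 * euler_prod (q ^ 3) ^ 3))
      - 1 / 3 * (euler_prod (q ^ 2) ^ 4 * euler_prod (q ^ 4) ^ 2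
               / (euler_prod q ^ 4 * euler_prod (q ^ 6) ^ 3))
      + 8 / 9 * (euler_prod (q ^ 4) ^ 11
               / (euler_prod q ^ 4 * euler_prod (q ^ 2) ^ 5 * euler_prod (q ^ 12) ^ 3))
      + 36 * q * (euler_prod (q ^ 4) ^ 2 * euler_prod (q ^ 3) ^ 9
               / (euler_prod q ^ 7 * euler_prod (q ^ 2) ^ 5))
      + 27 * q ^ 2 * (euler_prod (q ^ 4) ^ 2 * euler_prod (q ^ 6) ^ 9
               / (euler_prod q ^ 4 * euler_prod (q ^ 2) ^ 8))
      + 72 * q ^ 4 * (euler_prod (q ^ 12) ^ 9
               / (euler_prod q ^ 4 * euler_prod (q ^ 2) ^ 5 * euler_prod (q ^ 4)))" (is "_ \<and> _ = ?rhs")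
proof
  show "summable (\<lambda>n. of_nat (cphi 6 n) * q ^ n)"
    using CPhi_sums[OF assms] by (rule sums_summable)
  show "CPhi 6 q = ?rhs"
  proof (cases "q = 0")
    case True
    have "euler_prod 0 = 1" by (simp add: qpochhammer_inf_def)
    moreover have "CPhi 6 0 = 1" by (simp add: CPhi_def cphi_0 powser_zero)
    ultimately show ?thesis by (simp add: True)
  next
    case False
    then have q: "nome q" using assms by (simp add: nome_def)
    let ?E = "\<lambda>n :: nat. euler_prod (q ^ n)"
    have nonzero: "euler_prod q \<noteq> 0" "?E 2 \<noteq> 0" "?E 3 \<noteq> 0" "?E 4 \<noteq> 0" "?E 6 \<noteq> 0" "?E 12 \<noteq> 0"
      by (simp_all add: euler_prod_nonzero nome_power q)
    have "CPhi 6 q = (?E 4)\<^sup>2 / (euler_prod q ^ 4 * ?E 2 ^ 5) * (phi q * (euler_prod q ^ 6 * CPhi 6 q))"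
      using nonzero by (simp add: phi_eq_eta_quotient[OF q] divide_simps)
    also have "\<dots> = ?rhs"
      using nonzero unfolding CPhi_6_cubic[OF q]
      by (simp add: cubic_b_def cubic_c_def divide_simps flip: power_mult) algebra
    finally show ?thesis .
  qed
qed

end
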